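(* Consider the DISFOM algorithm with distance term $\phi(\mathbf{z})=\frac{\hat\rho}{2}\|\mathbf{z}\|_1^2$, $\hat\rho>0$, and the minibatch gradient estimate $G^k=\frac1m\sum_{i=1}^m\nabla F(\mathbf{x}^k,\zeta_i^k)$, as described in the context, under assumptions (A1)-(A4). Let $\epsilon>0$ and choose $$\eta=\frac1L,\quad K=\left\lceil\frac{\Delta L}{\epsilon^2}\right\rceil,\quad m=\left\lceil\frac{c(\log d)\sigma_\infty^2}{\epsilon^2}\right\rceil,\quad \hat\epsilon=\frac{\epsilon}{L}$$ (the auxiliary constants of the analysis being $\gamma=\frac12$, $\tau=\frac1L$, $t=\frac{2\eta}{\hat\rho}$). Then $$\mathbb{E}\big[\mathrm{dist}_{\|\cdot\|_\infty}(0,\partial(f+\delta_X)(\mathbf{x}^{Y+1}))\big]\le\Big(4\sqrt{3+1/\hat\rho+2\hat\rho}+2\sqrt{4\hat\rho^2+6\hat\rho+2}+2\Big)\epsilon ,$$ and the sample complexity of the algorithm (total number of samples of $\zeta$ used) is $$Km=\left\lceil\frac{\Delta L}{\epsilon^2}\right\rceil\left\lceil\frac{c(\log d)\sigma_\infty^2}{\epsilon^2}\right\rceil=\mathcal{O}\left(\frac{\Delta L(\log d)\sigma_\infty^2}{\epsilon^4}\right).$$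
   Context: Problem: minimize $f(\mathbf{x})=\mathbb{E}[F(\mathbf{x},\zeta)]$ over a nonempty closed convex set $X\subseteq\mathbb{R}^d$, $d\ge2$, where $\zeta$ is a random vector, $F(\cdot,\zeta)$ and $f$ are real-valued and differentiable on $\mathbb{R}^d$ ($f$ possibly nonconvex). $\|\cdot\|$ is the Euclidean norm. Assumptions. (A1) A stochastic first-order oracle returns $\nabla F(\mathbf{x},\zeta)$ for any input $(\mathbf{x},\zeta)$. (A2) With $w(\mathbf{x})=\nabla F(\mathbf{x},\zeta)-\nabla f(\mathbf{x})$: $\mathbb{E}[w(\mathbf{x})]=0$ and $\mathbb{E}[\exp(t\,w_i(\mathbf{x}))]\le\exp(\sigma_\infty^2t^2/2)$ for all $t\in\mathbb{R}$, $i=1,\dots,d$, $\mathbf{x}\in X$. (A3) $\|\nabla F(\mathbf{x},\zeta)-\nabla F(\mathbf{y},\zeta)\|\le L\|\mathbf{x}-\mathbf{y}\|$ for all $\mathbf{x},\mathbf{y}\in X$ and all $\zeta$, with $L>0$. (A4) $f(\mathbf{x})\ge\underline f$ for all $\mathbf{x}\in X$. Algorithm (DISFOM). Given an integer $K\ge1$, stepsize $\eta>0$, tolerance $\hat\epsilon\ge0$, and a (possibly random) $\mathbf{x}^1\in X$ with $\mathbb{E}[f(\mathbf{x}^1)]$ finite, for $k=1,\dots,K$: form a gradient estimate $G^k$, and compute $\mathbf{x}^{k+1}\in X$ as an approximate solution of $\min_{\mathbf{x}\in X}\frac12\|\mathbf{x}-(\mathbf{x}^k-\eta G^k)\|^2+\phi(\mathbf{x}-\mathbf{x}^k)$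 in the sense that there exist $\xi^{k+1},\Gamma^{k+1},\mathbf{y}^{k+1}\in\mathbb{R}^d$ with $(\mathbf{x}^{k+1}-\mathbf{x}^k+\eta G^k+\xi^{k+1}+\Gamma^{k+1})^T(\mathbf{x}-\mathbf{x}^{k+1})\ge0$ for all $\mathbf{x}\in X$; $\xi^{k+1}\in\partial\phi(\mathbf{y}^{k+1}-\mathbf{x}^k)$; $\|\Gamma^{k+1}\|\le\hat\epsilon$; $\|\mathbf{x}^{k+1}-\mathbf{y}^{k+1}\|_1\le\hat\epsilon$. Output $\mathbf{x}^{Y+1}$ with $Y$ uniform on $\{1,\dots,K\}$, independent of everything else. The samples $\zeta_i^k$ are i.i.d. copies of $\zeta$, those drawn at iteration $k$ being independent of $\mathbf{x}^1,\dots,\mathbf{x}^k$. Notation: $\Delta=\mathbb{E}[f(\mathbf{x}^1)]-\underline f$; $\delta_X$ is the indicator function of $X$; $\partial(f+\delta_X)(\mathbf{x})=\nabla f(\mathbf{x})+N_X(\mathbf{x})$ for $\mathbf{x}\in X$, with $N_X$ the normal cone; $\mathrm{dist}_{\|\cdot\|_\infty}(0,S)=\inf\{\|\mathbf{v}\|_\infty:\mathbf{v}\in S\}$. $c>0$ is an absolute constant such that, for every $d\ge2$ and $m\ge1$, the average $\bar w$ of $m$ i.i.d. mean-zero random vectors in $\mathbb{R}^d$ whose components satisfy the sub-Gaussian bound in (A2) satisfies $\mathbb{E}\|\bar w\|_\infty^2\le c(\log d)\sigma_\infty^2/m$ (such a $c$ exists, e.g. $c=12$). $\Delta$ and $\sigma_\infty$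 are positive. $\mathcal{O}(\cdot)$ hides absolute constants (including $c$) and is understood for sufficiently small $\epsilon$. *)

theory Defs
  imports "HOL-Probability.Probability"
begin

definition l1norm :: "real ^ 'n \<Rightarrow> real" where
  "l1norm x = (\<Sum>i\<in>UNIV. \<bar>x $ i\<bar>)"

definition subdiff :: "('a::real_inner \<Rightarrow> real) \<Rightarrow> 'a \<Rightarrow> 'a set" where
  "subdiff \<phi> z = {g. \<forall>u. \<phi> u \<ge> \<phi> z + g \<bullet> (u - z)}"

definition normal_cone :: "'a::real_inner set \<Rightarrow> 'a \<Rightarrow> 'a set" where
  "normal_cone X x = (if x \<in> X then {v. \<forall>u\<in>X. v \<bullet> (u - x) \<le> 0} else {})"

text \<open>The subdifferential of the sum of a differentiable function with gradient
  \<open>gf\<close> and the indicator function of the convex set \<open>X\<close>; it is empty outside \<open>X\<close>.\<close>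

definition subdiff_constrained :: "'a::real_inner set \<Rightarrow> ('a \<Rightarrow> 'a) \<Rightarrow> 'a \<Rightarrow> 'a set" where
  "subdiff_constrained X gf x = {gf x + v | v. v \<in> normal_cone X x}"

text \<open>Valued in \<^typ>\<open>ennreal\<close>, so that the distance to the empty set is infinite.\<close>

definition infdist0 :: "'a::euclidean_space set \<Rightarrow> ennreal" where
  "infdist0 S = (INF v\<in>S. ennreal (infnorm v))"

text \<open>An expectation of a nonnegative quantity is written as an integral in
  \<^typ>\<open>ennreal\<close>, so that an upper bound on it includes its finiteness.\<close>

definition sub_gaussian :: "'w measure \<Rightarrow> real \<Rightarrow> ('w \<Rightarrow> real) \<Rightarrow> bool" where
  "sub_gaussian M \<sigma> W \<longleftrightarrow>
     (\<forall>t. (\<integral>\<^sup>+\<omega>. ennreal (exp (t * W \<omega>)) \<partial>M) \<le> ennreal (exp (\<sigma>\<^sup>2 * t\<^sup>2 / 2)))"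

text \<open>The constant has to serve all dimensions \<open>d\<close> at once, so here a vector of dimension \<open>d\<close>
  is a function on \<open>{..<d}\<close>. Since the inequality only involves the joint law of the
  \<open>m\<close> i.i.d. vectors, they are taken as the coordinates of the \<open>m\<close>-fold product of their
  common law \<open>\<nu>\<close>.\<close>

definition subgaussian_mean_const :: "real \<Rightarrow> bool" where
  "subgaussian_mean_const c \<longleftrightarrow>
     (\<forall>d m (\<sigma>::real) (\<nu> :: (nat \<Rightarrow> real) measure).
        d \<ge> 2 \<longrightarrow> m \<ge> 1 \<longrightarrow> \<sigma> > 0 \<longrightarrow>
        prob_space \<nu> \<longrightarrow> sets \<nu> = sets (\<Pi>\<^sub>M i\<in>{..<d}. (borel :: real measure)) \<longrightarrow>
        (\<forall>i<d. integrable \<nu> (\<lambda>v. v i) \<and> (\<integral>v. v i \<partial>\<nu>) = 0 \<and>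
               sub_gaussian \<nu> \<sigma> (\<lambda>v. v i)) \<longrightarrow>
        (\<integral>\<^sup>+V. ennreal ((MAX i\<in>{..<d}. \<bar>(\<Sum>j<m. V j i) / real m\<bar>)\<^sup>2) \<partial>(\<Pi>\<^sub>M j\<in>{..<m}. \<nu>))
          \<le> ennreal (c * ln (real d) * \<sigma>\<^sup>2 / real m))"

text \<open>\<open>x'\<close> is an approximate minimizer over \<open>X\<close> of
  \<open>\<lambda>u. (norm (u - (x - \<eta> *\<^sub>R g)))\<^sup>2 / 2 + \<phi> (u - x)\<close>.\<close>

definition approx_step ::
    "(real ^ 'n) set \<Rightarrow> (real ^ 'n \<Rightarrow> real) \<Rightarrow> real \<Rightarrow> real \<Rightarrow> real ^ 'n \<Rightarrow> real ^ 'n \<Rightarrow> real ^ 'n \<Rightarrow> bool"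
  where
  "approx_step X \<phi> \<eta> \<epsilon>' x g x' \<longleftrightarrow>
     x' \<in> X \<and>
     (\<exists>\<xi> \<Gamma> y.
        (\<forall>u\<in>X. (x' - x + \<eta> *\<^sub>R g + \<xi> + \<Gamma>) \<bullet> (u - x') \<ge> 0) \<and>
        \<xi> \<in> subdiff \<phi> (y - x) \<and>
        norm \<Gamma> \<le> \<epsilon>' \<and>
        l1norm (x' - y) \<le> \<epsilon>')"

definition minibatch_grad ::
    "('a \<Rightarrow> 'z \<Rightarrow> 'a::real_vector) \<Rightarrow> nat \<Rightarrow> 'a \<Rightarrow> (nat \<Rightarrow> 'z) \<Rightarrow> 'a" where
  "minibatch_grad gF m x z = (1 / real m) *\<^sub>R (\<Sum>i=1..m. gF x (z i))"

text \<open>The pairs \<open>(k, i)\<close> such that iteration \<open>k\<close> draws an \<open>i\<close>-th sample.\<close>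

definition sample_indices :: "nat \<Rightarrow> nat \<Rightarrow> (nat \<times> nat) set" where
  "sample_indices K m = {1..K} \<times> {1..m}"

text \<open>Independence of two random variables of possibly different types, which the library's
  \<open>indep_var\<close> does not cover.\<close>

definition indep_rv ::
    "'w measure \<Rightarrow> 'a measure \<Rightarrow> ('w \<Rightarrow> 'a) \<Rightarrow> 'b measure \<Rightarrow> ('w \<Rightarrow> 'b) \<Rightarrow> bool" where
  "indep_rv M S U T V \<longleftrightarrow>
     U \<in> measurable M S \<and> V \<in> measurable M T \<and>
     prob_space.indep_set M {U -` A \<inter> space M | A. A \<in> sets S} {V -` B \<inter> space M | B. B \<in> sets T}"

text \<open>\<open>Z k i\<close> are the samples and \<open>x 1, \<dots>, x (K + 1)\<close> the iterates of a run with minibatch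
  size \<open>m\<close>; \<open>Y\<close> is the random output index.\<close>

definition disfom_run ::
    "'w measure \<Rightarrow> ('w \<Rightarrow> 'z::euclidean_space) \<Rightarrow> (real ^ 'n \<Rightarrow> 'z \<Rightarrow> real ^ 'n) \<Rightarrow> (real ^ 'n) set \<Rightarrow>
     (real ^ 'n \<Rightarrow> real) \<Rightarrow> real \<Rightarrow> real \<Rightarrow> nat \<Rightarrow> nat \<Rightarrow>
     (nat \<Rightarrow> nat \<Rightarrow> 'w \<Rightarrow> 'z) \<Rightarrow> (nat \<Rightarrow> 'w \<Rightarrow> real ^ 'n) \<Rightarrow> ('w \<Rightarrow> nat) \<Rightarrow> bool"
  where
  "disfom_run M \<zeta> gF X \<phi> \<eta> \<epsilon>' K m Z x Y \<longleftrightarrow>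
     (\<forall>k\<in>{1..K+1}. x k \<in> borel_measurable M) \<and>
     (\<forall>\<omega>\<in>space M. x 1 \<omega> \<in> X) \<and>
     (\<forall>k\<in>{1..K}. \<forall>\<omega>\<in>space M.
        approx_step X \<phi> \<eta> \<epsilon>' (x k \<omega>) (minibatch_grad gF m (x k \<omega>) (\<lambda>i. Z k i \<omega>)) (x (k+1) \<omega>)) \<and>
     prob_space.indep_vars M (\<lambda>_. borel) (\<lambda>p. Z (fst p) (snd p)) (sample_indices K m) \<and>
     (\<forall>(k, i)\<in>sample_indices K m. distr M borel (Z k i) = distr M borel \<zeta>) \<and>
     (\<forall>k\<in>{1..K}. indep_rv M
        (\<Pi>\<^sub>M j\<in>{1..k}. borel) (\<lambda>\<omega>. \<lambda>j\<in>{1..k}. x j \<omega>)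
        (\<Pi>\<^sub>M i\<in>{1..m}. borel) (\<lambda>\<omega>. \<lambda>i\<in>{1..m}. Z k i \<omega>)) \<and>
     distr M (count_space {1..K}) Y = uniform_count_measure {1..K} \<and>
     indep_rv M
        (count_space {1..K}) Y
        ((\<Pi>\<^sub>M j\<in>{1..K+1}. borel) \<Otimes>\<^sub>M (\<Pi>\<^sub>M p\<in>sample_indices K m. borel))
        (\<lambda>\<omega>. (\<lambda>j\<in>{1..K+1}. x j \<omega>, \<lambda>p\<in>sample_indices K m. Z (fst p) (snd p) \<omega>))"

definition num_iterations :: "real \<Rightarrow> real \<Rightarrow> real \<Rightarrow> nat" where
  "num_iterations \<Delta> L \<epsilon> = nat \<lceil>\<Delta> * L / \<epsilon>\<^sup>2\<rceil>"

definition batch_size :: "real \<Rightarrow> nat \<Rightarrow> real \<Rightarrow> real \<Rightarrow> nat" where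
  "batch_size c d \<sigma> \<epsilon> = nat \<lceil>c * ln (real d) * \<sigma>\<^sup>2 / \<epsilon>\<^sup>2\<rceil>"

end

theory Submission
  imports Defs
begin

text \<open>
  Write \<open>w\<close> for the gradient error in the maximum norm at the current iterate, \<open>r\<close> for \<open>L\<close> times the
  Euclidean length of the step from \<open>x\<close> to \<open>x'\<close>, and \<open>s\<close> for \<open>L\<close> times the \<open>l\<^sub>1\<close> length of the step
  from \<open>x\<close> to the auxiliary point \<open>y\<close> at which the distance term is subdifferentiated.  A single
  iteration gives two inequalities (\<open>approx_step_bounds\<close>).  Testing the variational inequality with
  \<open>x\<close> itself and using the descent lemma yields
  \<open>r\<^sup>2 / 2 + \<rho> s\<^sup>2 \<le> L (f x - f x') + \<rho> s \<epsilon> + r \<epsilon> + w s + w \<epsilon>\<close>, because the subgradients \<open>\<xi>\<close> of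
  \<open>\<rho>/2 \<parallel>z\<parallel>\<^sub>1\<^sup>2\<close> satisfy \<open>\<xi> \<bullet> z \<ge> \<rho> \<parallel>z\<parallel>\<^sub>1\<^sup>2\<close> and \<open>\<parallel>\<xi>\<parallel>\<^sub>\<infinity> \<le> \<rho> \<parallel>z\<parallel>\<^sub>1\<close>.  Reading the same variational
  inequality as membership in the normal cone at \<open>x'\<close> bounds the stationarity measure there by
  \<open>2 r + \<rho> s + w + \<epsilon>\<close>.  It is the \<open>l\<^sub>1\<close> distance term that lets the noise enter through its maximum
  norm only, and the maximum norm of a sub-Gaussian mean costs a factor \<open>ln d\<close> instead of \<open>d\<close>.

  Completing squares turns the two inequalities into one that is linear in \<open>w\<^sup>2\<close> and in the decrease
  of \<open>f\<close>: the stationarity measure is at most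
  \<open>a \<epsilon> + (b / \<epsilon>) w\<^sup>2 + (\<theta> L / \<epsilon>) (f x - f x')\<close>, with \<open>a + b + \<theta>\<close> at most the constant of the
  theorem (\<open>quadratic_tradeoff\<close>, \<open>approx_step_stationarity\<close>).  This holds on every sample path, so that
  expectations only have to be taken of terms that are easy to control.  The output index is uniform
  and independent of the run, so the expectation at the output is the average over the iterations
  (\<open>nn_integral_uniform_index\<close>).  The decreases of \<open>f\<close> telescope to at most \<open>\<Delta>\<close>, and
  \<open>L \<Delta> \<le> K \<epsilon>\<^sup>2\<close>.  The fresh samples are independent of the iterate, so the iterate may be frozen
  when averaging over them, and the mean square of \<open>w\<close> is at most \<open>\<epsilon>\<^sup>2\<close>
  (\<open>minibatch_mean_square_le\<close>).  Altogether the expectation is at most \<open>(a + b + \<theta>) \<epsilon>\<close>.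
\<close>

section \<open>A quadratic trade-off\<close>

lemma linear_le_square:
  fixes \<alpha> \<beta> t :: real
  assumes "\<alpha> > 0"
  shows "\<beta> * t \<le> \<alpha> * t\<^sup>2 + \<beta>\<^sup>2 / (4 * \<alpha>)"
proof -
  have "\<alpha> * t\<^sup>2 + \<beta>\<^sup>2 / (4 * \<alpha>) - \<beta> * t = \<alpha> * (t - \<beta> / (2 * \<alpha>))\<^sup>2"
    using assms by (simp add: field_simps power2_eq_square)
  also have "\<dots> \<ge> 0"
    using assms by simp
  finally show ?thesis by simp
qed

text \<open>Used to divide a subgradient inequality by the length \<open>t\<close> of a perturbation and let \<open>t\<close> tend to \<open>0\<close>.\<close>

lemma le_of_le_add_small:
  fixes a b c :: real
  assumes "\<And>t. 0 < t \<Longrightarrow> t \<le> 1 \<Longrightarrow> a \<le> b + c * t"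
  shows "a \<le> b"
proof (rule tendsto_lowerbound)
  show "((\<lambda>t. b + c * t) \<longlongrightarrow> b) (at_right 0)"
    by (auto intro!: tendsto_eq_intros)
  show "\<forall>\<^sub>F t in at_right 0. a \<le> b + c * t"
    unfolding eventually_at_right_field
    using assms by (intro exI[of _ 1]) auto
qed simp

text \<open>The left-hand side is the constant that the optimal weight in \<open>quadratic_tradeoff\<close> produces.
  Splitting off \<open>(\<rho> / 2)\<^sup>2\<close> under its square root leaves a term that the first root on the right
  absorbs; the second root exceeds \<open>2 \<rho> + 5 / 4\<close> and absorbs the remaining terms.\<close>

lemma tradeoff_constant_le:
  fixes \<rho> :: real
  assumes "\<rho> > 0"
  shows "sqrt ((8 + \<rho>) * (3 + \<rho> / 4 + 1 / (4 * \<rho>))) + 4 + (\<rho> + 1) / 2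
    \<le> 4 * sqrt (3 + 1 / \<rho> + 2 * \<rho>) + 2 * sqrt (4 * \<rho>\<^sup>2 + 6 * \<rho> + 2) + 2"
proof -
  have e: "(8 + \<rho>) * (3 + \<rho> / 4 + 1 / (4 * \<rho>)) = (97 / 4 + 5 * \<rho> + 2 / \<rho>) + (\<rho> / 2)\<^sup>2"
    using assms by (simp add: field_simps power2_eq_square)
  have "sqrt ((8 + \<rho>) * (3 + \<rho> / 4 + 1 / (4 * \<rho>))) \<le> sqrt (97 / 4 + 5 * \<rho> + 2 / \<rho>) + sqrt ((\<rho> / 2)\<^sup>2)"
    unfolding e using assms by (intro sqrt_add_le_add_sqrt) auto
  moreover have "sqrt (97 / 4 + 5 * \<rho> + 2 / \<rho>) \<le> sqrt (16 * (3 + 1 / \<rho> + 2 * \<rho>))"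
  proof (rule real_sqrt_le_mono)
    have "2 / \<rho> \<le> 16 / \<rho>"
      using assms by (intro divide_right_mono) auto
    then show "97 / 4 + 5 * \<rho> + 2 / \<rho> \<le> 16 * (3 + 1 / \<rho> + 2 * \<rho>)"
      using assms by simp
  qed
  moreover have "sqrt (16 * (3 + 1 / \<rho> + 2 * \<rho>)) = 4 * sqrt (3 + 1 / \<rho> + 2 * \<rho>)"
    by (simp only: real_sqrt_mult) simp
  moreover have "2 * \<rho> + 5 / 4 \<le> sqrt (4 * \<rho>\<^sup>2 + 6 * \<rho> + 2)"
    using assms by (intro real_le_rsqrt) (simp add: field_simps power2_eq_square)
  moreover have "sqrt ((\<rho> / 2)\<^sup>2) = \<rho> / 2"
    using assms by simp
  moreover have "p + 4 + (\<rho> + 1) / 2 \<le> 4 * q + 2 * r + 2"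
    if "p \<le> u + \<rho> / 2" "u \<le> 4 * q" "2 * \<rho> + 5 / 4 \<le> r" for p q r u :: real
    using that assms by (simp add: add_divide_distrib)
  ultimately show ?thesis
    by metis
qed

text \<open>Subtract \<open>\<theta>\<close> times the quadratic constraint from the linear objective and maximize what is left
  over \<open>r\<close> and \<open>s\<close> separately; the maximum is a quadratic polynomial in \<open>w\<close>, and \<open>2 w \<le> w\<^sup>2 + 1\<close>
  removes its linear term.  When \<open>w\<^sup>2\<close> and \<open>h\<close> have mean at most \<open>1\<close>, the mean of the objective is
  at most \<open>a + b + \<theta>\<close>, which is why this sum is the quantity to be kept small.  The lemma is the
  case \<open>\<epsilon> = 1\<close> of the bound needed for one iteration.\<close>

lemma quadratic_tradeoff:
  fixes \<rho> :: real
  assumes \<rho>: "\<rho> > 0"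
  obtains a b \<theta> :: real
  where "a \<ge> 0" "b \<ge> 0" "\<theta> > 0"
    and "a + b + \<theta> \<le> 4 * sqrt (3 + 1 / \<rho> + 2 * \<rho>) + 2 * sqrt (4 * \<rho>\<^sup>2 + 6 * \<rho> + 2) + 2"
    and "\<And>r s w h. r\<^sup>2 / 2 + \<rho> * s\<^sup>2 \<le> h + \<rho> * s + r + w * s + w \<Longrightarrow>
      2 * r + \<rho> * s + w + 1 \<le> a + b * w\<^sup>2 + \<theta> * h"
proof -
  define B where "B = 3 + \<rho> / 4 + 1 / (4 * \<rho>)"
  \<comment> \<open>The minimizer of \<open>t B + (8 + \<rho>) / (4 t)\<close>, the part of \<open>a + b + t\<close> that depends on the weight \<open>t\<close>.\<close>
  define \<theta> where "\<theta> = sqrt ((8 + \<rho>) / (4 * B))"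
  define p where "p = \<theta> + (1 + \<theta>) / 2 + 1"
  define a where "a = p / 2 + (2 + \<theta>)\<^sup>2 / (2 * \<theta>) + (1 + \<theta>)\<^sup>2 * \<rho> / (4 * \<theta>) + 1"
  define b where "b = p / 2 + \<theta> / (4 * \<rho>)"
  have B: "B > 0"
    using \<rho> by (simp add: B_def add_pos_pos)
  have \<theta>: "\<theta> > 0"
    using \<rho> B by (simp add: \<theta>_def)
  have p: "p \<ge> 0"
    using \<theta> by (simp add: p_def)
  have "a + b + \<theta> = \<theta> * B + (8 + \<rho>) / (4 * \<theta>) + 4 + (\<rho> + 1) / 2"
    using \<theta> \<rho> by (simp add: a_def b_def p_def B_def field_simps power2_eq_square)
  also have "\<theta> * B + (8 + \<rho>) / (4 * \<theta>) = sqrt ((8 + \<rho>) * B)"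
  proof -
    have sq: "\<theta>\<^sup>2 = (8 + \<rho>) / (4 * B)"
      using \<rho> B by (simp add: \<theta>_def)
    have "(8 + \<rho>) / (4 * \<theta>) = \<theta> * B"
      using sq \<theta> B by (simp add: field_simps power2_eq_square)
    moreover have "sqrt ((8 + \<rho>) * B) = 2 * (\<theta> * B)"
    proof (rule real_sqrt_unique)
      show "(2 * (\<theta> * B))\<^sup>2 = (8 + \<rho>) * B"
        using sq B by (simp add: power_mult_distrib power2_eq_square field_simps)
    qed (use \<theta> B in simp)
    ultimately show ?thesis by simp
  qed
  also have "sqrt ((8 + \<rho>) * B) + 4 + (\<rho> + 1) / 2
      \<le> 4 * sqrt (3 + 1 / \<rho> + 2 * \<rho>) + 2 * sqrt (4 * \<rho>\<^sup>2 + 6 * \<rho> + 2) + 2"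
    using tradeoff_constant_le[OF \<rho>] by (simp add: B_def)
  finally have sum: "a + b + \<theta> \<le> 4 * sqrt (3 + 1 / \<rho> + 2 * \<rho>) + 2 * sqrt (4 * \<rho>\<^sup>2 + 6 * \<rho> + 2) + 2" .
  have bound: "2 * r + \<rho> * s + w + 1 \<le> a + b * w\<^sup>2 + \<theta> * h"
    if "r\<^sup>2 / 2 + \<rho> * s\<^sup>2 \<le> h + \<rho> * s + r + w * s + w" for r s w h
  proof -
    have "\<theta> * (r\<^sup>2 / 2 + \<rho> * s\<^sup>2) \<le> \<theta> * (h + \<rho> * s + r + w * s + w)"
      using that \<theta> by (intro mult_left_mono) auto
    moreover have "(2 + \<theta>) * r \<le> \<theta> / 2 * r\<^sup>2 + (2 + \<theta>)\<^sup>2 / (2 * \<theta>)"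
      using linear_le_square[of "\<theta> / 2" "2 + \<theta>" r] \<theta> by simp
    moreover have "(\<rho> + \<theta> * \<rho> + \<theta> * w) * s
        \<le> \<theta> * \<rho> * s\<^sup>2 + (\<rho> + \<theta> * \<rho> + \<theta> * w)\<^sup>2 / (4 * (\<theta> * \<rho>))"
      using \<theta> \<rho> by (intro linear_le_square) simp
    moreover have "(\<rho> + \<theta> * \<rho> + \<theta> * w)\<^sup>2 / (4 * (\<theta> * \<rho>))
        = (1 + \<theta>)\<^sup>2 * \<rho> / (4 * \<theta>) + (1 + \<theta>) / 2 * w + \<theta> / (4 * \<rho>) * w\<^sup>2"
      using \<theta> \<rho> by (simp add: field_simps power2_eq_square)
    moreover have "p * w \<le> p / 2 + p / 2 * w\<^sup>2"
      using mult_left_mono[OF sum_squares_bound[of w 1] p] by (simp add: algebra_simps)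
    ultimately show ?thesis
      by (simp add: a_def b_def p_def algebra_simps)
  qed
  show thesis
    by (rule that[OF _ _ \<theta> sum bound]) (use p \<theta> \<rho> in \<open>simp_all add: a_def b_def\<close>)
qed


section \<open>The squared l1 norm as distance term\<close>

lemma l1norm_nonneg: "0 \<le> l1norm x"
  by (simp add: l1norm_def sum_nonneg)

lemma l1norm_triangle: "l1norm (x + y) \<le> l1norm x + l1norm y"
  by (simp add: l1norm_def flip: sum.distrib) (intro sum_mono abs_triangle_ineq)

lemma l1norm_scaleR: "l1norm (r *\<^sub>R x) = \<bar>r\<bar> * l1norm x"
  by (simp add: l1norm_def abs_mult sum_distrib_left)

lemma l1norm_axis: "l1norm (axis i r) = \<bar>r\<bar>"
  by (simp add: l1norm_def axis_def if_distrib[of abs] cong: if_cong)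

text \<open>The duality between the two norms: it is what lets the gradient error be measured in the maximum
  norm as soon as the step is measured in the \<open>l\<^sub>1\<close> norm.\<close>

lemma abs_inner_le_infnorm_l1norm:
  fixes g z :: "real ^ 'n"
  shows "\<bar>g \<bullet> z\<bar> \<le> infnorm g * l1norm z"
proof -
  have "\<bar>g \<bullet> z\<bar> \<le> (\<Sum>i\<in>UNIV. \<bar>g $ i\<bar> * \<bar>z $ i\<bar>)"
    unfolding inner_vec_def by (rule order_trans[OF sum_abs]) (simp add: abs_mult)
  also have "\<dots> \<le> (\<Sum>i\<in>UNIV. infnorm g * \<bar>z $ i\<bar>)"
    by (intro sum_mono mult_right_mono component_le_infnorm_cart) auto
  finally show ?thesis
    by (simp add: l1norm_def sum_distrib_left)
qed

lemma infnorm_cart_le_iff: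
  fixes v :: "real ^ 'n"
  shows "infnorm v \<le> b \<longleftrightarrow> (\<forall>i. \<bar>v $ i\<bar> \<le> b)"
proof
  assume "infnorm v \<le> b"
  then show "\<forall>i. \<bar>v $ i\<bar> \<le> b"
    using component_le_infnorm_cart[of v] order_trans by blast
next
  assume "\<forall>i. \<bar>v $ i\<bar> \<le> b"
  then show "infnorm v \<le> b"
    unfolding infnorm_cart by (intro cSup_least) auto
qed

lemma subdiffD: "g \<in> subdiff \<phi> z \<Longrightarrow> \<phi> z + g \<bullet> (u - z) \<le> \<phi> u"
  by (simp add: subdiff_def)

text \<open>For a positively homogeneous function of degree two Euler's identity makes this an equality; the
  inequality is obtained by comparing \<open>z\<close> with the shrunken point \<open>(1 - t) z\<close>.\<close>

lemma subdiff_sq_l1norm_inner_ge: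
  fixes \<xi> z :: "real ^ 'n"
  assumes \<xi>: "\<xi> \<in> subdiff (\<lambda>z. \<rho> / 2 * (l1norm z)\<^sup>2) z"
  shows "\<rho> * (l1norm z)\<^sup>2 \<le> \<xi> \<bullet> z"
proof (rule le_of_le_add_small[where c = "\<rho> / 2 * (l1norm z)\<^sup>2"])
  fix t :: real
  assume t: "0 < t" "t \<le> 1"
  have "\<rho> / 2 * (l1norm z)\<^sup>2 + \<xi> \<bullet> ((1 - t) *\<^sub>R z - z) \<le> \<rho> / 2 * ((1 - t) * l1norm z)\<^sup>2"
    using subdiffD[OF \<xi>, of "(1 - t) *\<^sub>R z"] t
    by (simp add: l1norm_scaleR)
  then have "0 \<le> \<rho> / 2 * ((1 - t) * l1norm z)\<^sup>2 - \<rho> / 2 * (l1norm z)\<^sup>2 + t * (\<xi> \<bullet> z)"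
    by (simp add: inner_diff_right left_diff_distrib)
  also have "\<dots> = t * (\<xi> \<bullet> z + \<rho> / 2 * (l1norm z)\<^sup>2 * t) - t * (\<rho> * (l1norm z)\<^sup>2)"
    by (simp add: algebra_simps power2_eq_square)
  finally have "t * (\<rho> * (l1norm z)\<^sup>2) \<le> t * (\<xi> \<bullet> z + \<rho> / 2 * (l1norm z)\<^sup>2 * t)"
    by (simp only: diff_ge_0_iff_ge)
  then show "\<rho> * (l1norm z)\<^sup>2 \<le> \<xi> \<bullet> z + \<rho> / 2 * (l1norm z)\<^sup>2 * t"
    using t(1) by (simp only: mult_le_cancel_left_pos)
qed

text \<open>Moving a distance \<open>t\<close> along the \<open>i\<close>-th axis, in the direction of the sign of \<open>\<xi> $ i\<close>, gains
  \<open>t \<bar>\<xi> $ i\<bar>\<close> in the linear minorant, while the \<open>l\<^sub>1\<close> norm grows by at most \<open>t\<close>.\<close>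

lemma subdiff_sq_l1norm_infnorm_le:
  fixes \<xi> z :: "real ^ 'n"
  assumes \<rho>: "\<rho> \<ge> 0"
    and \<xi>: "\<xi> \<in> subdiff (\<lambda>z. \<rho> / 2 * (l1norm z)\<^sup>2) z"
  shows "infnorm \<xi> \<le> \<rho> * l1norm z"
  unfolding infnorm_cart_le_iff
proof (rule allI, rule le_of_le_add_small[where c = "\<rho> / 2"])
  fix i and t :: real
  assume t: "0 < t" "t \<le> 1"
  define e :: "real ^ 'n" where "e = axis i (t * sgn (\<xi> $ i))"
  have le: "l1norm e \<le> t"
    using t by (auto simp: e_def l1norm_axis abs_mult abs_sgn_eq)
  have "t * \<bar>\<xi> $ i\<bar> = \<xi> \<bullet> (z + e - z)"
    by (simp add: e_def inner_axis abs_sgn mult.left_commute)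
  also have "\<dots> \<le> \<rho> / 2 * (l1norm (z + e))\<^sup>2 - \<rho> / 2 * (l1norm z)\<^sup>2"
    using subdiffD[OF \<xi>, of "z + e"] by simp
  also have "\<dots> \<le> \<rho> / 2 * (l1norm z + t)\<^sup>2 - \<rho> / 2 * (l1norm z)\<^sup>2"
    using \<rho> le l1norm_triangle[of z e]
    by (intro diff_right_mono mult_left_mono power_mono l1norm_nonneg) auto
  also have "\<dots> = t * (\<rho> * l1norm z + \<rho> / 2 * t)"
    by (simp add: field_simps power2_eq_square)
  finally show "\<bar>\<xi> $ i\<bar> \<le> \<rho> * l1norm z + \<rho> / 2 * t"
    using t(1) by (simp only: mult_le_cancel_left_pos)
qed


section \<open>Deterministic analysis of one iteration\<close>

text \<open>Along the segment from \<open>u\<close> to \<open>v\<close>, which stays in \<open>X\<close> by convexity, the difference between \<open>f\<close> and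
  the quadratic upper model based at \<open>u\<close> has nonpositive derivative.\<close>

lemma descent_lemma:
  fixes f :: "'a::real_inner \<Rightarrow> real"
  assumes X: "convex X" "u \<in> X" "v \<in> X"
    and grad: "\<And>u. GDERIV f u :> gf u"
    and lip: "\<And>u v. u \<in> X \<Longrightarrow> v \<in> X \<Longrightarrow> norm (gf u - gf v) \<le> L * norm (u - v)"
  shows "f v \<le> f u + gf u \<bullet> (v - u) + L / 2 * (norm (v - u))\<^sup>2"
proof -
  define h where "h = (\<lambda>t. f (u + t *\<^sub>R (v - u)) - t * (gf u \<bullet> (v - u)) - L / 2 * (norm (v - u))\<^sup>2 * t\<^sup>2)"
  have "h 1 \<le> h 0"
  proof (rule DERIV_nonpos_imp_nonincreasing[where f = h and a = 0 and b = 1])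
    fix t :: real
    assume t: "0 \<le> t" "t \<le> 1"
    define p where "p = u + t *\<^sub>R (v - u)"
    have p: "p \<in> X"
      using X t convexD_alt[of X u v t] by (simp add: p_def algebra_simps)
    have "((\<lambda>t. f (u + t *\<^sub>R (v - u))) has_derivative (\<lambda>s. (s *\<^sub>R (v - u)) \<bullet> gf p)) (at t)"
      by (rule has_derivative_compose[where g = f and f = "\<lambda>t. u + t *\<^sub>R (v - u)"])
        (auto intro!: derivative_eq_intros grad[unfolded gderiv_def] simp: p_def)
    then have "((\<lambda>t. f (u + t *\<^sub>R (v - u))) has_real_derivative (v - u) \<bullet> gf p) (at t)"
      by (simp add: has_field_derivative_def mult_commute_abs)
    then have "DERIV h t :> (v - u) \<bullet> gf p - gf u \<bullet> (v - u) - L * (norm (v - u))\<^sup>2 * t"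
      unfolding h_def by (auto intro!: derivative_eq_intros)
    moreover have "(v - u) \<bullet> gf p - gf u \<bullet> (v - u) - L * (norm (v - u))\<^sup>2 * t \<le> 0"
    proof -
      have "(v - u) \<bullet> gf p - gf u \<bullet> (v - u) = (gf p - gf u) \<bullet> (v - u)"
        by (simp add: inner_diff_left inner_diff_right inner_commute)
      also have "\<dots> \<le> norm (gf p - gf u) * norm (v - u)"
        by (rule norm_cauchy_schwarz)
      also have "\<dots> \<le> L * norm (p - u) * norm (v - u)"
        by (intro mult_right_mono lip p X) simp
      also have "\<dots> = L * (norm (v - u))\<^sup>2 * t"
        using t by (simp add: p_def power2_eq_square)
      finally show ?thesis by simp
    qed
    ultimately show "\<exists>y. DERIV h t :> y \<and> y \<le> 0" by blast
  qed simp
  then show ?thesis by (simp add: h_def)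
qed

text \<open>Both conclusions come from the variational inequality that defines an approximate step: the first
  by testing it at the old point \<open>u\<close> and inserting the descent lemma, the second by observing that
  it puts \<open>- L\<close> times its left vector into the normal cone at \<open>u'\<close>.  The witnesses are \<open>L\<close> times the Euclidean norm of \<open>u' - u\<close>
  and \<open>L\<close> times the \<open>l\<^sub>1\<close> norm of \<open>y - u\<close>.  Keeping the \<open>l\<^sub>1\<close> norm at \<open>y\<close>, where the subgradient
  lives, instead of at \<open>u'\<close> avoids losing another multiple of the tolerance.\<close>

lemma approx_step_bounds:
  fixes X :: "(real ^ 'n) set" and g :: "real ^ 'n"
  assumes X: "convex X" "u \<in> X"
    and grad: "\<And>u. GDERIV f u :> gf u"
    and lip: "\<And>u v. u \<in> X \<Longrightarrow> v \<in> X \<Longrightarrow> norm (gf u - gf v) \<le> L * norm (u - v)"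
    and pos: "L > 0" "\<rho> > 0"
    and step: "approx_step X (\<lambda>z. \<rho> / 2 * (l1norm z)\<^sup>2) (1 / L) (\<epsilon> / L) u g u'"
  obtains r s where "r \<ge> 0" "s \<ge> 0"
    "r\<^sup>2 / 2 + \<rho> * s\<^sup>2 \<le> L * (f u - f u') + \<rho> * s * \<epsilon> + r * \<epsilon>
       + infnorm (g - gf u) * s + infnorm (g - gf u) * \<epsilon>"
    "infdist0 (subdiff_constrained X gf u') \<le> ennreal (2 * r + \<rho> * s + infnorm (g - gf u) + \<epsilon>)"
proof -
  obtain \<xi> \<Gamma> y where u': "u' \<in> X"
    and opt: "\<And>v. v \<in> X \<Longrightarrow> (u' - u + (1 / L) *\<^sub>R g + \<xi> + \<Gamma>) \<bullet> (v - u') \<ge> 0"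
    and \<xi>: "\<xi> \<in> subdiff (\<lambda>z. \<rho> / 2 * (l1norm z)\<^sup>2) (y - u)"
    and \<Gamma>: "norm \<Gamma> \<le> \<epsilon> / L" and y: "l1norm (u' - y) \<le> \<epsilon> / L"
    using step unfolding approx_step_def by blast
  define d where "d = u' - u"
  define w where "w = infnorm (g - gf u)"
  define N where "N = l1norm (y - u)"
  have \<epsilon>: "\<epsilon> / L \<ge> 0"
    using norm_ge_zero[of \<Gamma>] \<Gamma> by linarith
  have w: "w \<ge> 0"
    by (simp add: w_def infnorm_pos_le)
  have N: "N \<ge> 0"
    by (simp add: N_def l1norm_nonneg)
  have \<xi>N: "infnorm \<xi> \<le> \<rho> * N"
    using subdiff_sq_l1norm_infnorm_le[OF _ \<xi>] pos by (simp add: N_def)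
  have l1d: "l1norm d \<le> N + \<epsilon> / L"
    using l1norm_triangle[of "y - u" "u' - y"] y by (simp add: d_def N_def)
  have \<xi>d: "\<rho> * N\<^sup>2 - \<rho> * N * (\<epsilon> / L) \<le> \<xi> \<bullet> d"
  proof -
    have "\<bar>\<xi> \<bullet> (u' - y)\<bar> \<le> infnorm \<xi> * l1norm (u' - y)"
      by (rule abs_inner_le_infnorm_l1norm)
    also have "\<dots> \<le> \<rho> * N * (\<epsilon> / L)"
      using \<xi>N y pos N by (intro mult_mono l1norm_nonneg) auto
    finally have "- (\<rho> * N * (\<epsilon> / L)) \<le> \<xi> \<bullet> (u' - y)"
      by linarith
    moreover have "\<rho> * N\<^sup>2 \<le> \<xi> \<bullet> (y - u)"
      using subdiff_sq_l1norm_inner_ge[OF \<xi>] by (simp add: N_def)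
    moreover have "\<xi> \<bullet> d = \<xi> \<bullet> (y - u) + \<xi> \<bullet> (u' - y)"
      by (simp add: d_def flip: inner_add_right)
    ultimately show ?thesis by linarith
  qed
  have \<Gamma>d: "- (\<epsilon> / L * norm d) \<le> \<Gamma> \<bullet> d"
    using Cauchy_Schwarz_ineq2[of \<Gamma> d] mult_right_mono[OF \<Gamma>, of "norm d"] by simp
  have wd: "- (w * (N + \<epsilon> / L)) \<le> (g - gf u) \<bullet> d"
    using abs_inner_le_infnorm_l1norm[of "g - gf u" d] mult_left_mono[OF l1d w]
    by (simp add: w_def)
  have "0 \<le> L * ((d + (1 / L) *\<^sub>R g + \<xi> + \<Gamma>) \<bullet> (- d))"
    using opt[OF X(2)] pos by (simp add: d_def)
  also have "\<dots> = - (L * (norm d)\<^sup>2) - g \<bullet> d - L * (\<xi> \<bullet> d) - L * (\<Gamma> \<bullet> d)"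
    using pos by (simp add: inner_add_left power2_norm_eq_inner right_diff_distrib)
  also have "\<dots> \<le> - (L * (norm d)\<^sup>2) - g \<bullet> d - L * (\<rho> * N\<^sup>2 - \<rho> * N * (\<epsilon> / L)) - L * (- (\<epsilon> / L * norm d))"
    using pos \<xi>d \<Gamma>d by (intro diff_mono mult_left_mono) auto
  finally have "g \<bullet> d \<le> - (L * (norm d)\<^sup>2) - L * \<rho> * N\<^sup>2 + \<rho> * N * \<epsilon> + \<epsilon> * norm d"
    using pos by (simp add: algebra_simps)
  moreover have "f u' \<le> f u + gf u \<bullet> d + L / 2 * (norm d)\<^sup>2"
    using descent_lemma[OF X u' grad lip] by (simp add: d_def)
  ultimately have "f u' - f u
      \<le> - (L / 2 * (norm d)\<^sup>2) - L * \<rho> * N\<^sup>2 + \<rho> * N * \<epsilon> + \<epsilon> * norm d + w * (N + \<epsilon> / L)"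
    using wd by (simp add: inner_diff_left)
  then have "L * (f u' - f u)
      \<le> L * (- (L / 2 * (norm d)\<^sup>2) - L * \<rho> * N\<^sup>2 + \<rho> * N * \<epsilon> + \<epsilon> * norm d + w * (N + \<epsilon> / L))"
    using pos by (intro mult_left_mono) auto
  also have "\<dots> = - ((L * norm d)\<^sup>2 / 2) - \<rho> * (L * N)\<^sup>2 + \<rho> * (L * N) * \<epsilon> + L * norm d * \<epsilon>
      + w * (L * N) + w * \<epsilon>"
    using pos by (simp add: field_simps power2_eq_square)
  finally have ineq: "(L * norm d)\<^sup>2 / 2 + \<rho> * (L * N)\<^sup>2
      \<le> L * (f u - f u') + \<rho> * (L * N) * \<epsilon> + L * norm d * \<epsilon> + w * (L * N) + w * \<epsilon>"
    by (simp add: algebra_simps)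
  define v where "v = - L *\<^sub>R (d + (1 / L) *\<^sub>R g + \<xi> + \<Gamma>)"
  have "v \<bullet> (a - u') \<le> 0" if "a \<in> X" for a
    using opt[OF that] pos by (simp add: v_def d_def mult_nonneg_nonneg)
  then have "v \<in> normal_cone X u'"
    using u' by (simp add: normal_cone_def)
  then have "infdist0 (subdiff_constrained X gf u') \<le> ennreal (infnorm (gf u' + v))"
    unfolding infdist0_def subdiff_constrained_def by (intro INF_lower) blast
  also have "\<dots> \<le> ennreal (2 * (L * norm d) + \<rho> * (L * N) + w + \<epsilon>)"
  proof (intro ennreal_leI infnorm_cart_le_iff[THEN iffD2] allI)
    fix i
    have "(gf u' + v) $ i = (gf u' - gf u) $ i - (g - gf u) $ i - L * d $ i - L * \<xi> $ i - L * \<Gamma> $ i"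
      using pos by (simp add: v_def algebra_simps)
    moreover have "\<bar>(gf u' - gf u) $ i\<bar> \<le> L * norm d"
      using component_le_norm_cart[of "gf u' - gf u" i] lip[OF u' X(2)] by (simp add: d_def)
    moreover have "\<bar>(g - gf u) $ i\<bar> \<le> w"
      unfolding w_def by (rule component_le_infnorm_cart)
    moreover have "\<bar>L * d $ i\<bar> \<le> L * norm d"
      using component_le_norm_cart[of d i] pos by (simp add: abs_mult)
    moreover have "\<bar>L * \<xi> $ i\<bar> \<le> \<rho> * (L * N)"
      using order_trans[OF component_le_infnorm_cart \<xi>N] pos by (simp add: abs_mult mult.left_commute[of \<rho>])
    moreover have "\<bar>L * \<Gamma> $ i\<bar> \<le> \<epsilon>"
      using order_trans[OF component_le_norm_cart \<Gamma>, of i] pos by (simp add: abs_mult field_simps)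
    ultimately show "\<bar>(gf u' + v) $ i\<bar> \<le> 2 * (L * norm d) + \<rho> * (L * N) + w + \<epsilon>"
      by linarith
  qed
  finally show thesis
    using that[of "L * norm d" "L * N"] ineq pos N by (simp add: w_def)
qed

text \<open>The assumption on \<open>a\<close>, \<open>b\<close>, \<open>\<theta>\<close> is the outcome of \<open>quadratic_tradeoff\<close>, applied after division of
  \<open>r\<close>, \<open>s\<close>, \<open>w\<close> by \<open>\<epsilon>\<close> and of \<open>L\<close> times the decrease of \<open>f\<close> by \<open>\<epsilon>\<^sup>2\<close>.
  Nonnegativity of the bound is recorded because sums of bounds are later moved in and out of extended nonnegative reals, where negative values would be truncated.\<close>

lemma approx_step_stationarity:
  fixes X :: "(real ^ 'n) set" and g :: "real ^ 'n"
  assumes X: "convex X" "u \<in> X"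
    and grad: "\<And>u. GDERIV f u :> gf u"
    and lip: "\<And>u v. u \<in> X \<Longrightarrow> v \<in> X \<Longrightarrow> norm (gf u - gf v) \<le> L * norm (u - v)"
    and pos: "L > 0" "\<rho> > 0" "\<epsilon> > 0"
    and step: "approx_step X (\<lambda>z. \<rho> / 2 * (l1norm z)\<^sup>2) (1 / L) (\<epsilon> / L) u g u'"
    and tradeoff: "\<And>r s w h. r\<^sup>2 / 2 + \<rho> * s\<^sup>2 \<le> h + \<rho> * s + r + w * s + w \<Longrightarrow>
      2 * r + \<rho> * s + w + 1 \<le> a + b * w\<^sup>2 + \<theta> * h"
  defines "B \<equiv> a * \<epsilon> + b / \<epsilon> * (infnorm (g - gf u))\<^sup>2 + \<theta> * L / \<epsilon> * (f u - f u')"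
  shows "infdist0 (subdiff_constrained X gf u') \<le> ennreal B" and "B \<ge> 0"
proof -
  define w where "w = infnorm (g - gf u)"
  obtain r s where r: "r \<ge> 0" and s: "s \<ge> 0"
    and quad: "r\<^sup>2 / 2 + \<rho> * s\<^sup>2 \<le> L * (f u - f u') + \<rho> * s * \<epsilon> + r * \<epsilon> + w * s + w * \<epsilon>"
    and dist: "infdist0 (subdiff_constrained X gf u') \<le> ennreal (2 * r + \<rho> * s + w + \<epsilon>)"
    using approx_step_bounds[OF X grad lip pos(1,2) step] unfolding w_def by metis
  have "(r / \<epsilon>)\<^sup>2 / 2 + \<rho> * (s / \<epsilon>)\<^sup>2 = (r\<^sup>2 / 2 + \<rho> * s\<^sup>2) / \<epsilon>\<^sup>2"
    by (simp add: power_divide add_divide_distrib)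
  also have "\<dots> \<le> (L * (f u - f u') + \<rho> * s * \<epsilon> + r * \<epsilon> + w * s + w * \<epsilon>) / \<epsilon>\<^sup>2"
    using quad by (intro divide_right_mono) auto
  also have "\<dots> = L * (f u - f u') / \<epsilon>\<^sup>2 + \<rho> * (s / \<epsilon>) + r / \<epsilon> + w / \<epsilon> * (s / \<epsilon>) + w / \<epsilon>"
    using pos by (simp add: field_simps power2_eq_square)
  finally have "2 * (r / \<epsilon>) + \<rho> * (s / \<epsilon>) + w / \<epsilon> + 1
      \<le> a + b * (w / \<epsilon>)\<^sup>2 + \<theta> * (L * (f u - f u') / \<epsilon>\<^sup>2)"
    by (rule tradeoff)
  then have "\<epsilon> * (2 * (r / \<epsilon>) + \<rho> * (s / \<epsilon>) + w / \<epsilon> + 1)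
      \<le> \<epsilon> * (a + b * (w / \<epsilon>)\<^sup>2 + \<theta> * (L * (f u - f u') / \<epsilon>\<^sup>2))"
    using pos by (intro mult_left_mono) auto
  moreover have "\<epsilon> * (2 * (r / \<epsilon>) + \<rho> * (s / \<epsilon>) + w / \<epsilon> + 1) = 2 * r + \<rho> * s + w + \<epsilon>"
    using pos by (simp add: field_simps)
  moreover have "\<epsilon> * (a + b * (w / \<epsilon>)\<^sup>2 + \<theta> * (L * (f u - f u') / \<epsilon>\<^sup>2)) = B"
    using pos by (simp add: B_def w_def field_simps power2_eq_square)
  ultimately have le: "2 * r + \<rho> * s + w + \<epsilon> \<le> B"
    by simp
  show "infdist0 (subdiff_constrained X gf u') \<le> ennreal B"
    using dist ennreal_leI[OF le] by (rule order_trans)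
  have "0 \<le> 2 * r + \<rho> * s + w + \<epsilon>"
    using r s pos by (simp add: w_def infnorm_pos_le)
  then show "B \<ge> 0"
    using le by linarith
qed


section \<open>Measurability of gradients\<close>

lemma GDERIV_difference_quotient_LIMSEQ:
  fixes f :: "'a::real_inner \<Rightarrow> real"
  assumes "GDERIV f u :> D"
  shows "(\<lambda>n. real (Suc n) * (f (u + inverse (real (Suc n)) *\<^sub>R h) - f u)) \<longlonglongrightarrow> D \<bullet> h"
proof -
  have "((\<lambda>t. f (u + t *\<^sub>R h)) has_derivative (\<lambda>s. (s *\<^sub>R h) \<bullet> D)) (at 0)"
    by (rule has_derivative_compose[where g = f and f = "\<lambda>t. u + t *\<^sub>R h"])
      (use assms in \<open>auto intro!: derivative_eq_intros simp: gderiv_def\<close>)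
  then have "((\<lambda>t. f (u + t *\<^sub>R h)) has_real_derivative D \<bullet> h) (at 0)"
    by (simp add: has_field_derivative_def mult_commute_abs inner_commute)
  then have "((\<lambda>t. (f (u + t *\<^sub>R h) - f u) / t) \<longlongrightarrow> D \<bullet> h) (at 0)"
    by (simp add: has_field_derivative_iff)
  moreover have "filterlim (\<lambda>n. inverse (real (Suc n))) (at 0) sequentially"
    using LIMSEQ_inverse_real_of_nat by (simp add: filterlim_at)
  ultimately have "(\<lambda>n. (f (u + inverse (real (Suc n)) *\<^sub>R h) - f u) / inverse (real (Suc n)))
      \<longlonglongrightarrow> D \<bullet> h"
    by (rule filterlim_compose)
  then show ?thesis
    by (simp add: divide_inverse mult.commute del: of_nat_Suc)
qed

text \<open>Joint measurability of the stochastic gradient in the point and the sample is inherited from the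
  function: each directional component is a pointwise limit of difference quotients.\<close>

lemma borel_measurable_parametric_gradient:
  fixes F :: "'a::euclidean_space \<Rightarrow> 'z \<Rightarrow> real"
  assumes F: "(\<lambda>(u, z). F u z) \<in> borel_measurable (borel \<Otimes>\<^sub>M N)"
    and grad: "\<And>u z. GDERIV (\<lambda>v. F v z) u :> gF u z"
  shows "(\<lambda>(u, z). gF u z) \<in> borel_measurable (borel \<Otimes>\<^sub>M N)"
proof (subst borel_measurable_euclidean_space, intro ballI)
  fix b :: 'a
  have F': "(\<lambda>p. F (f p) (g p)) \<in> borel_measurable P"
    if [measurable]: "f \<in> borel_measurable P" "g \<in> measurable P N" for f g and P :: "('a \<times> 'z) measure"
    using measurable_compose[OF _ F, of "\<lambda>p. (f p, g p)" P] by simp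
  show "(\<lambda>p. (case p of (u, z) \<Rightarrow> gF u z) \<bullet> b) \<in> borel_measurable (borel \<Otimes>\<^sub>M N)"
  proof (rule borel_measurable_LIMSEQ_real)
    show "(\<lambda>n. real (Suc n) * (F (fst p + inverse (real (Suc n)) *\<^sub>R b) (snd p) - F (fst p) (snd p)))
        \<longlonglongrightarrow> (case p of (u, z) \<Rightarrow> gF u z) \<bullet> b" for p
      using GDERIV_difference_quotient_LIMSEQ[OF grad, of "fst p" b "snd p"]
      by (simp add: case_prod_beta)
  qed (intro borel_measurable_times borel_measurable_const borel_measurable_diff F'; measurable)
qed

lemma borel_measurable_gradient:
  fixes f :: "'a::euclidean_space \<Rightarrow> real"
  assumes grad: "\<And>u. GDERIV f u :> gf u"
  shows "gf \<in> borel_measurable borel"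
proof -
  have "continuous_on UNIV f"
    using grad unfolding gderiv_def
    by (intro continuous_at_imp_continuous_on ballI has_derivative_continuous)
  then have [measurable]: "f \<in> borel_measurable borel"
    by (rule borel_measurable_continuous_onI)
  \<comment> \<open>A function without parameter is treated as one with a parameter of unit type.\<close>
  have "(\<lambda>(u, z::unit). f u) \<in> borel_measurable (borel \<Otimes>\<^sub>M count_space UNIV)"
    by measurable
  then have "(\<lambda>(u, z::unit). gf u) \<in> borel_measurable (borel \<Otimes>\<^sub>M count_space UNIV)"
    using grad by (rule borel_measurable_parametric_gradient)
  from measurable_compose[OF _ this, of "\<lambda>u. (u, ())" borel] show ?thesis
    by simp
qed

lemma borel_measurable_minibatch_error:
  fixes gF :: "'a::euclidean_space \<Rightarrow> 'z::topological_space \<Rightarrow> 'a"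
  assumes gF: "(\<lambda>(u, z). gF u z) \<in> borel_measurable (borel \<Otimes>\<^sub>M borel)"
    and gf: "gf \<in> borel_measurable borel"
    and p: "p \<in> borel_measurable P"
    and q: "\<And>i. i \<in> {1..m} \<Longrightarrow> q i \<in> borel_measurable P"
  shows "(\<lambda>\<omega>. (infnorm (minibatch_grad gF m (p \<omega>) (\<lambda>i. q i \<omega>) - gf (p \<omega>)))\<^sup>2) \<in> borel_measurable P"
proof -
  have infnorm: "(infnorm :: 'a \<Rightarrow> real) \<in> borel_measurable borel"
    by (intro borel_measurable_continuous_onI continuous_on_infnorm continuous_on_id)
  have "(\<lambda>\<omega>. gF (p \<omega>) (q i \<omega>)) \<in> borel_measurable P" if "i \<in> {1..m}" for i
    using measurable_compose[OF measurable_Pair[OF p q[OF that]] gF] by simp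
  then show ?thesis
    unfolding minibatch_grad_def
    by (intro borel_measurable_power measurable_compose[OF _ infnorm] borel_measurable_diff
        borel_measurable_scaleR borel_measurable_sum borel_measurable_const measurable_compose[OF p gf])
qed


section \<open>Independence and random indices\<close>

lemma indep_rv_compose:
  assumes M: "prob_space M"
    and indep: "indep_rv M S U T V"
    and p: "p \<in> measurable S S'" and q: "q \<in> measurable T T'"
  shows "indep_rv M S' (\<lambda>\<omega>. p (U \<omega>)) T' (\<lambda>\<omega>. q (V \<omega>))"
proof -
  interpret prob_space M by fact
  have U: "U \<in> measurable M S" and V: "V \<in> measurable M T"
    using indep by (auto simp: indep_rv_def)
  have "prob (((\<lambda>\<omega>. p (U \<omega>)) -` A \<inter> space M) \<inter> ((\<lambda>\<omega>. q (V \<omega>)) -` B \<inter> space M))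
      = prob ((\<lambda>\<omega>. p (U \<omega>)) -` A \<inter> space M) * prob ((\<lambda>\<omega>. q (V \<omega>)) -` B \<inter> space M)"
    if A: "A \<in> sets S'" and B: "B \<in> sets T'" for A B
  proof -
    have "(\<lambda>\<omega>. p (U \<omega>)) -` A \<inter> space M = U -` (p -` A \<inter> space S) \<inter> space M"
      using measurable_space[OF U] by auto
    moreover have "(\<lambda>\<omega>. q (V \<omega>)) -` B \<inter> space M = V -` (q -` B \<inter> space T) \<inter> space M"
      using measurable_space[OF V] by auto
    ultimately show ?thesis
      using indep measurable_sets[OF p A] measurable_sets[OF q B]
      unfolding indep_rv_def indep_sets2_eq by blast
  qed
  moreover have "(\<lambda>\<omega>. p (U \<omega>)) \<in> measurable M S'" "(\<lambda>\<omega>. q (V \<omega>)) \<in> measurable M T'"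
    using measurable_compose[OF U p] measurable_compose[OF V q] .
  ultimately show ?thesis
    unfolding indep_rv_def indep_sets2_eq by (auto intro: measurable_sets)
qed

text \<open>Independence makes the joint law of \<open>U\<close> and \<open>V\<close> the product of their laws, so \<open>U\<close> may be frozen
  while averaging over \<open>V\<close>.  This takes the place of conditioning on the past of the algorithm.\<close>

lemma nn_integral_indep_rv:
  assumes M: "prob_space M"
    and indep: "indep_rv M S U T V"
    and h: "h \<in> borel_measurable (S \<Otimes>\<^sub>M T)"
  shows "(\<integral>\<^sup>+\<omega>. h (U \<omega>, V \<omega>) \<partial>M) = (\<integral>\<^sup>+\<omega>. \<integral>\<^sup>+\<omega>'. h (U \<omega>, V \<omega>') \<partial>M \<partial>M)"
proof -
  interpret prob_space M by fact
  have U [measurable]: "U \<in> measurable M S" and V [measurable]: "V \<in> measurable M T"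
    using indep by (auto simp: indep_rv_def)
  interpret U: prob_space "distr M S U"
    by (rule prob_space_distr[OF U])
  interpret V: prob_space "distr M T V"
    by (rule prob_space_distr[OF V])
  have joint: "distr M S U \<Otimes>\<^sub>M distr M T V = distr M (S \<Otimes>\<^sub>M T) (\<lambda>\<omega>. (U \<omega>, V \<omega>))"
  proof (rule pair_measure_eqI)
    fix A B
    assume "A \<in> sets (distr M S U)" "B \<in> sets (distr M T V)"
    then have A: "A \<in> sets S" and B: "B \<in> sets T"
      by auto
    have "(\<lambda>\<omega>. (U \<omega>, V \<omega>)) -` (A \<times> B) \<inter> space M = (U -` A \<inter> space M) \<inter> (V -` B \<inter> space M)"
      by auto
    moreover have "prob ((U -` A \<inter> space M) \<inter> (V -` B \<inter> space M))
        = prob (U -` A \<inter> space M) * prob (V -` B \<inter> space M)"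
      using indep A B unfolding indep_rv_def indep_sets2_eq by blast
    ultimately show "emeasure (distr M S U) A * emeasure (distr M T V) B
        = emeasure (distr M (S \<Otimes>\<^sub>M T) (\<lambda>\<omega>. (U \<omega>, V \<omega>))) (A \<times> B)"
      using A B by (simp add: emeasure_distr emeasure_eq_measure ennreal_mult)
  qed (simp_all add: U.sigma_finite_measure_axioms V.sigma_finite_measure_axioms)
  have h' [measurable]: "h \<in> borel_measurable (S \<Otimes>\<^sub>M distr M T V)"
      "h \<in> borel_measurable (distr M S U \<Otimes>\<^sub>M distr M T V)"
    using h by simp_all
  have "(\<integral>\<^sup>+\<omega>. h (U \<omega>, V \<omega>) \<partial>M) = (\<integral>\<^sup>+p. h p \<partial>(distr M S U \<Otimes>\<^sub>M distr M T V))"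
    unfolding joint using h by (subst nn_integral_distr) auto
  also have "\<dots> = (\<integral>\<^sup>+u. \<integral>\<^sup>+v. h (u, v) \<partial>distr M T V \<partial>distr M S U)"
    by (rule V.nn_integral_fst[symmetric]) (rule h')
  also have "\<dots> = (\<integral>\<^sup>+\<omega>. \<integral>\<^sup>+v. h (U \<omega>, v) \<partial>distr M T V \<partial>M)"
    using V.borel_measurable_nn_integral_fst[OF h'(1)]
    by (subst nn_integral_distr) auto
  also have "\<dots> = (\<integral>\<^sup>+\<omega>. \<integral>\<^sup>+\<omega>'. h (U \<omega>, V \<omega>') \<partial>M \<partial>M)"
  proof (rule nn_integral_cong)
    fix \<omega>
    assume "\<omega> \<in> space M"
    then have "U \<omega> \<in> space S"
      by (rule measurable_space[OF U])
    then show "(\<integral>\<^sup>+v. h (U \<omega>, v) \<partial>distr M T V) = (\<integral>\<^sup>+\<omega>'. h (U \<omega>, V \<omega>') \<partial>M)"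
      using h by (subst nn_integral_distr) auto
  qed
  finally show ?thesis .
qed

lemma nn_integral_uniform_index:
  assumes M: "prob_space M"
    and I: "finite I" "I \<noteq> {}"
    and Y: "distr M (count_space I) Y = uniform_count_measure I"
    and indep: "indep_rv M (count_space I) Y N V"
    and b: "\<And>k. k \<in> I \<Longrightarrow> b k \<in> borel_measurable N"
  shows "(\<integral>\<^sup>+\<omega>. b (Y \<omega>) (V \<omega>) \<partial>M) = (\<Sum>k\<in>I. \<integral>\<^sup>+\<omega>. b k (V \<omega>) \<partial>M) / of_nat (card I)"
proof -
  have [measurable]: "Y \<in> measurable M (count_space I)"
    using indep by (simp add: indep_rv_def)
  have "(\<lambda>p. b (fst p) (snd p)) \<in> borel_measurable (count_space I \<Otimes>\<^sub>M N)"
    using b I by (intro measurable_pair_measure_countable1) (auto intro: countable_finite)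
  from nn_integral_indep_rv[OF M indep this]
  have "(\<integral>\<^sup>+\<omega>. b (Y \<omega>) (V \<omega>) \<partial>M) = (\<integral>\<^sup>+\<omega>. \<integral>\<^sup>+\<omega>'. b (Y \<omega>) (V \<omega>') \<partial>M \<partial>M)"
    by simp
  also have "\<dots> = (\<integral>\<^sup>+k. \<integral>\<^sup>+\<omega>'. b k (V \<omega>') \<partial>M \<partial>distr M (count_space I) Y)"
    by (subst nn_integral_distr) auto
  also have "\<dots> = (\<Sum>k\<in>I. (\<integral>\<^sup>+\<omega>. b k (V \<omega>) \<partial>M) * ennreal (1 / card I))"
    unfolding Y uniform_count_measure_def using I(1)
    by (subst nn_integral_point_measure_finite) (simp_all add: mult.commute)
  also have "ennreal (1 / card I) = inverse (of_nat (card I))"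
    using I by (simp add: inverse_ennreal card_gt_0_iff ennreal_of_nat_eq_real_of_nat inverse_eq_divide)
  also have "(\<Sum>k\<in>I. (\<integral>\<^sup>+\<omega>. b k (V \<omega>) \<partial>M) * inverse (of_nat (card I)))
      = (\<Sum>k\<in>I. \<integral>\<^sup>+\<omega>. b k (V \<omega>) \<partial>M) / of_nat (card I)"
    by (simp add: divide_ennreal_def sum_distrib_right)
  finally show ?thesis .
qed

lemma (in prob_space) indep_vars_reindex:
  assumes indep: "indep_vars N X (h ` I)" and inj: "inj_on h I"
  shows "indep_vars (\<lambda>i. N (h i)) (\<lambda>i. X (h i)) I"
proof -
  have "prob (\<Inter>j\<in>J. A j) = (\<Prod>j\<in>J. prob (A j))"
    if J: "J \<subseteq> I" "J \<noteq> {}" "finite J"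
      and A: "A \<in> (\<Pi> j\<in>J. {X (h j) -` B \<inter> space M |B. B \<in> sets (N (h j))})" for J A
  proof -
    define g where "g = the_inv_into J h"
    have inj_J: "inj_on h J"
      using inj J(1) by (rule inj_on_subset)
    have g: "g (h j) = j" if "j \<in> J" for j
      unfolding g_def using inj_J that by (rule the_inv_into_f_f)
    have "prob (\<Inter>i\<in>h ` J. A (g i)) = (\<Prod>i\<in>h ` J. prob (A (g i)))"
    proof (rule indep_setsD[where I = "h ` I" and F = "\<lambda>i. {X i -` B \<inter> space M |B. B \<in> sets (N i)}"])
      show "indep_sets (\<lambda>i. {X i -` B \<inter> space M |B. B \<in> sets (N i)}) (h ` I)"
        using indep by (simp add: indep_vars_def2)
      show "\<forall>i\<in>h ` J. A (g i) \<in> {X i -` B \<inter> space M |B. B \<in> sets (N i)}"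
        using A by (auto simp: g Pi_iff)
    qed (use J in auto)
    then show ?thesis
      by (simp add: prod.reindex[OF inj_J] g)
  qed
  moreover have "random_variable (N (h i)) (X (h i))" if "i \<in> I" for i
    using indep that by (simp add: indep_vars_def2)
  ultimately show ?thesis
    unfolding indep_vars_def2 indep_sets_def by (auto intro: measurable_sets)
qed


section \<open>Means of sub-Gaussian gradient errors\<close>

text \<open>Transfers the Lipschitz bound from the sample gradients to the gradient of the expected
  objective: a pointwise bound on a difference bounds the difference of the means.\<close>

lemma (in prob_space) norm_mean_diff_le:
  fixes A B :: "'a \<Rightarrow> 'b::{banach, second_countable_topology}"
  assumes A: "integrable M (\<lambda>\<omega>. A \<omega> - \<alpha>)" "(\<integral>\<omega>. A \<omega> - \<alpha> \<partial>M) = 0"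
    and B: "integrable M (\<lambda>\<omega>. B \<omega> - \<beta>)" "(\<integral>\<omega>. B \<omega> - \<beta> \<partial>M) = 0"
    and le: "\<And>\<omega>. norm (A \<omega> - B \<omega>) \<le> C"
  shows "norm (\<alpha> - \<beta>) \<le> C"
proof -
  have mean: "integrable M D \<and> (\<integral>\<omega>. D \<omega> \<partial>M) = \<delta>"
    if D: "integrable M (\<lambda>\<omega>. D \<omega> - \<delta>)" "(\<integral>\<omega>. D \<omega> - \<delta> \<partial>M) = 0" for D :: "'a \<Rightarrow> 'b" and \<delta>
  proof -
    have "integrable M (\<lambda>\<omega>. (D \<omega> - \<delta>) + \<delta>)"
      by (rule Bochner_Integration.integrable_add[OF D(1)]) simp
    then have int: "integrable M D" by simp
    then have "(\<integral>\<omega>. D \<omega> - \<delta> \<partial>M) = (\<integral>\<omega>. D \<omega> \<partial>M) - \<delta>"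
      by (simp add: prob_space)
    with int D(2) show ?thesis by simp
  qed
  have int: "integrable M A" "integrable M B"
    using mean[OF A] mean[OF B] by simp_all
  have "norm (\<alpha> - \<beta>) = norm (\<integral>\<omega>. A \<omega> - B \<omega> \<partial>M)"
    using mean[OF A] mean[OF B] by simp
  also have "\<dots> \<le> (\<integral>\<omega>. norm (A \<omega> - B \<omega>) \<partial>M)"
    by (rule integral_norm_bound)
  also have "\<dots> \<le> (\<integral>\<omega>. C \<partial>M)"
    using int le by (intro integral_mono) auto
  finally show ?thesis by (simp add: prob_space)
qed

text \<open>The defining property of \<open>c\<close> speaks of product measures on functions from \<open>{..<d}\<close> to the reals, so
  the centred sample gradients are transported there along an enumeration of the index type; the
  law of the batch of transported vectors is the required product measure because the samples are
  independent and identically distributed.\<close>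

lemma minibatch_mean_square_le:
  fixes G :: "'z::topological_space \<Rightarrow> real ^ 'n" and Z :: "nat \<Rightarrow> 'w \<Rightarrow> 'z" and m :: nat
  assumes M: "prob_space M" and c: "subgaussian_mean_const c"
    and dim: "CARD('n) \<ge> 2" and m: "m \<ge> 1" and \<sigma>: "\<sigma> > 0"
    and G: "G \<in> borel_measurable borel" and \<zeta>: "\<zeta> \<in> borel_measurable M"
    and indep: "prob_space.indep_vars M (\<lambda>_. borel) Z {1..m}"
    and ident: "\<And>i. i \<in> {1..m} \<Longrightarrow> distr M borel (Z i) = distr M borel \<zeta>"
    and mean: "integrable M (\<lambda>\<omega>. G (\<zeta> \<omega>) - g)" "(\<integral>\<omega>. G (\<zeta> \<omega>) - g \<partial>M) = 0"
    and tail: "\<And>i. sub_gaussian M \<sigma> (\<lambda>\<omega>. (G (\<zeta> \<omega>) - g) $ i)"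
  shows "(\<integral>\<^sup>+\<omega>. ennreal ((infnorm ((1 / real m) *\<^sub>R (\<Sum>i=1..m. G (Z i \<omega>)) - g))\<^sup>2) \<partial>M)
    \<le> ennreal (c * ln (real CARD('n)) * \<sigma>\<^sup>2 / real m)"
proof -
  interpret prob_space M by fact
  define d where "d = CARD('n)"
  obtain e :: "nat \<Rightarrow> 'n" where e: "bij_betw e {..<d} UNIV"
    using ex_bij_betw_nat_finite[of "UNIV :: 'n set"] by (auto simp: d_def atLeast0LessThan)
  define P where "P = (\<Pi>\<^sub>M i\<in>{..<d}. (borel :: real measure))"
  define h where "h = (\<lambda>z. \<lambda>i\<in>{..<d}. (G z - g) $ e i)"
  define \<nu> where "\<nu> = distr M P (\<lambda>\<omega>. h (\<zeta> \<omega>))"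
  have comp: "(\<lambda>z. (G z - g) $ i) \<in> borel_measurable borel" for i
    using G by (intro measurable_compose[OF _ borel_measurable_nth] borel_measurable_diff borel_measurable_const)
  have h: "h \<in> measurable borel P"
    unfolding h_def P_def by (intro measurable_restrict comp)
  have h\<zeta>: "(\<lambda>\<omega>. h (\<zeta> \<omega>)) \<in> measurable M P"
    using \<zeta> h by (rule measurable_compose)
  have \<nu>: "prob_space \<nu>"
    unfolding \<nu>_def by (rule prob_space_distr[OF h\<zeta>])
  have coord: "(\<lambda>v. v i) \<in> borel_measurable P" if "i < d" for i
    unfolding P_def using that by (intro measurable_component_singleton) simp
  have coord_law: "integrable \<nu> (\<lambda>v. v i) \<and> (\<integral>v. v i \<partial>\<nu>) = 0 \<and> sub_gaussian \<nu> \<sigma> (\<lambda>v. v i)"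
    if i: "i < d" for i
  proof (intro conjI)
    have eq: "h z i = (G z - g) $ e i" for z
      using i by (simp add: h_def)
    show "integrable \<nu> (\<lambda>v. v i)"
      unfolding \<nu>_def integrable_distr_eq[OF h\<zeta> coord[OF i]] eq
      by (rule integrable_bounded_linear[OF bounded_linear_vec_nth mean(1)])
    have "(\<integral>v. v i \<partial>\<nu>) = (\<integral>\<omega>. (G (\<zeta> \<omega>) - g) $ e i \<partial>M)"
      unfolding \<nu>_def integral_distr[OF h\<zeta> coord[OF i]] eq ..
    also have "\<dots> = 0"
      using integral_bounded_linear[OF bounded_linear_vec_nth mean(1)] mean(2) by simp
    finally show "(\<integral>v. v i \<partial>\<nu>) = 0" .
    show "sub_gaussian \<nu> \<sigma> (\<lambda>v. v i)"
      unfolding sub_gaussian_def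
    proof
      fix t
      have "(\<integral>\<^sup>+v. ennreal (exp (t * v i)) \<partial>\<nu>) = (\<integral>\<^sup>+\<omega>. ennreal (exp (t * (G (\<zeta> \<omega>) - g) $ e i)) \<partial>M)"
        unfolding \<nu>_def using h\<zeta> coord[OF i] by (subst nn_integral_distr) (simp_all add: eq)
      then show "(\<integral>\<^sup>+v. ennreal (exp (t * v i)) \<partial>\<nu>) \<le> ennreal (exp (\<sigma>\<^sup>2 * t\<^sup>2 / 2))"
        using tail[of "e i"] by (simp add: sub_gaussian_def)
    qed
  qed
  have Suc_image: "Suc ` {..<m} = {1..m}"
    by (simp add: lessThan_atLeast0 image_Suc_atLeastLessThan atLeastLessThanSuc_atLeastAtMost)
  have "indep_vars (\<lambda>_. borel) (\<lambda>j. Z (Suc j)) {..<m}"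
    using indep_vars_reindex[of "\<lambda>_. borel" Z Suc "{..<m}"] indep by (simp add: Suc_image)
  then have hZ_indep: "indep_vars (\<lambda>_. P) (\<lambda>j \<omega>. h (Z (Suc j) \<omega>)) {..<m}"
    by (rule indep_vars_compose2) (rule h)
  have Z: "Z (Suc j) \<in> borel_measurable M" if "j < m" for j
    using indep that by (simp add: indep_vars_def2)
  have hZ: "(\<lambda>\<omega>. h (Z (Suc j) \<omega>)) \<in> measurable M P" if "j < m" for j
    using Z[OF that] h by (rule measurable_compose)
  have hZ_law: "distr M P (\<lambda>\<omega>. h (Z (Suc j) \<omega>)) = \<nu>" if "j < m" for j
    using distr_distr[OF h Z[OF that]] distr_distr[OF h \<zeta>] ident[of "Suc j"] that
    by (simp add: \<nu>_def comp_def)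
  have joint: "distr M (\<Pi>\<^sub>M j\<in>{..<m}. P) (\<lambda>\<omega>. \<lambda>j\<in>{..<m}. h (Z (Suc j) \<omega>)) = (\<Pi>\<^sub>M j\<in>{..<m}. \<nu>)"
  proof -
    have "distr M (\<Pi>\<^sub>M j\<in>{..<m}. P) (\<lambda>\<omega>. \<lambda>j\<in>{..<m}. h (Z (Suc j) \<omega>))
        = (\<Pi>\<^sub>M j\<in>{..<m}. distr M P (\<lambda>\<omega>. h (Z (Suc j) \<omega>)))"
      using hZ_indep m by (subst indep_vars_iff_distr_eq_PiM'[symmetric]) (auto intro: hZ simp: lessThan_empty_iff)
    also have "\<dots> = (\<Pi>\<^sub>M j\<in>{..<m}. \<nu>)"
      by (intro PiM_cong) (simp_all add: hZ_law)
    finally show ?thesis .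
  qed
  define H where "H = (\<lambda>V :: nat \<Rightarrow> nat \<Rightarrow> real. ennreal ((MAX i\<in>{..<d}. \<bar>(\<Sum>j<m. V j i) / real m\<bar>)\<^sup>2))"
  have H: "H \<in> borel_measurable (\<Pi>\<^sub>M j\<in>{..<m}. P)"
  proof -
    have "(\<lambda>V. V j i) \<in> borel_measurable (\<Pi>\<^sub>M j\<in>{..<m}. P)" if "j < m" "i < d" for j i
      by (rule measurable_compose[OF measurable_component_singleton[of j "{..<m}" "\<lambda>_. P"] coord[OF that(2)]])
        (use that in simp)
    then show ?thesis
      unfolding H_def
      by (intro measurable_compose[OF _ measurable_ennreal] borel_measurable_power borel_measurable_Max
          borel_measurable_abs borel_measurable_divide borel_measurable_sum borel_measurable_const) auto
  qed
  have "(\<integral>\<^sup>+\<omega>. ennreal ((infnorm ((1 / real m) *\<^sub>R (\<Sum>i=1..m. G (Z i \<omega>)) - g))\<^sup>2) \<partial>M)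
      \<le> (\<integral>\<^sup>+\<omega>. H (\<lambda>j\<in>{..<m}. h (Z (Suc j) \<omega>)) \<partial>M)"
  proof (intro nn_integral_mono)
    fix \<omega>
    have "infnorm ((1 / real m) *\<^sub>R (\<Sum>i=1..m. G (Z i \<omega>)) - g)
        \<le> (MAX i\<in>{..<d}. \<bar>(\<Sum>j<m. (\<lambda>j\<in>{..<m}. h (Z (Suc j) \<omega>)) j i) / real m\<bar>)"
      unfolding infnorm_cart_le_iff
    proof
      fix i :: 'n
      obtain l where l: "l < d" "i = e l"
        using e unfolding bij_betw_def by auto
      have "(\<Sum>j<m. (\<lambda>j\<in>{..<m}. h (Z (Suc j) \<omega>)) j l) = (\<Sum>j<m. (G (Z (Suc j) \<omega>) - g) $ i)"
        using l by (simp add: h_def)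
      also have "\<dots> = (\<Sum>k=1..m. (G (Z k \<omega>)) $ i) - real m * g $ i"
        unfolding Suc_image[symmetric] by (subst sum.reindex) (simp_all add: sum_subtractf)
      finally have "((1 / real m) *\<^sub>R (\<Sum>i=1..m. G (Z i \<omega>)) - g) $ i
          = (\<Sum>j<m. (\<lambda>j\<in>{..<m}. h (Z (Suc j) \<omega>)) j l) / real m"
        using m by (simp add: sum_component field_simps)
      then show "\<bar>((1 / real m) *\<^sub>R (\<Sum>i=1..m. G (Z i \<omega>)) - g) $ i\<bar>
          \<le> (MAX i\<in>{..<d}. \<bar>(\<Sum>j<m. (\<lambda>j\<in>{..<m}. h (Z (Suc j) \<omega>)) j i) / real m\<bar>)"
        using l by (intro Max_ge) auto
    qed
    then show "ennreal ((infnorm ((1 / real m) *\<^sub>R (\<Sum>i=1..m. G (Z i \<omega>)) - g))\<^sup>2)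
        \<le> H (\<lambda>j\<in>{..<m}. h (Z (Suc j) \<omega>))"
      unfolding H_def by (intro ennreal_leI power_mono) (auto simp: infnorm_pos_le)
  qed
  also have "\<dots> = (\<integral>\<^sup>+V. H V \<partial>(\<Pi>\<^sub>M j\<in>{..<m}. \<nu>))"
    unfolding joint[symmetric] using H
    by (subst nn_integral_distr) (auto intro!: measurable_restrict hZ)
  also have "\<dots> \<le> ennreal (c * ln (real d) * \<sigma>\<^sup>2 / real m)"
    using c[unfolded subgaussian_mean_const_def, rule_format, of d m \<sigma> \<nu>] dim m \<sigma> \<nu> coord_law
    by (simp add: H_def \<nu>_def P_def d_def)
  finally show ?thesis by (simp add: d_def)
qed


section \<open>Sample complexity\<close>

text \<open>Once \<open>\<epsilon>\<^sup>2\<close> is below both numerators, each rounding up at most doubles the quantity rounded.\<close>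

lemma num_samples_bigo:
  assumes c: "c > 0"
  shows "\<exists>C>0. \<forall>\<Delta> L \<sigma> d. \<Delta> > 0 \<longrightarrow> L > 0 \<longrightarrow> \<sigma> > 0 \<longrightarrow> d \<ge> 2 \<longrightarrow>
    (\<forall>\<^sub>F \<epsilon> in at_right 0.
       real (card (sample_indices (num_iterations \<Delta> L \<epsilon>) (batch_size c d \<sigma> \<epsilon>)))
         \<le> C * (\<Delta> * L * ln (real d) * \<sigma>\<^sup>2 / \<epsilon> ^ 4))"
proof (intro exI[of _ "4 * c"] conjI allI impI)
  fix \<Delta> L \<sigma> :: real and d :: nat
  assume pos: "\<Delta> > 0" "L > 0" "\<sigma> > 0" and d: "d \<ge> 2"
  have ceil: "\<forall>\<^sub>F \<epsilon> in at_right 0. real (nat \<lceil>a / \<epsilon>\<^sup>2\<rceil>) \<le> 2 * (a / \<epsilon>\<^sup>2)" if a: "a > 0" for a :: real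
    unfolding eventually_at_right_field
  \<comment> \<open>For \<open>\<epsilon>\<close> below this threshold the quotient is at least 1, where rounding up at most doubles.\<close>
  proof (intro exI[of _ "sqrt a"] conjI allI impI)
    fix \<epsilon> :: real
    assume \<epsilon>: "0 < \<epsilon>" "\<epsilon> < sqrt a"
    have "\<epsilon>\<^sup>2 < (sqrt a)\<^sup>2"
      using \<epsilon> by (intro power_strict_mono) auto
    then have "1 \<le> a / \<epsilon>\<^sup>2"
      using \<epsilon> a by simp
    then show "real (nat \<lceil>a / \<epsilon>\<^sup>2\<rceil>) \<le> 2 * (a / \<epsilon>\<^sup>2)"
      by linarith
  qed (use a in simp)
  have lnd: "ln (real d) > 0"
    using d by simp
  have "\<forall>\<^sub>F \<epsilon> in at_right 0. real (nat \<lceil>\<Delta> * L / \<epsilon>\<^sup>2\<rceil>) \<le> 2 * (\<Delta> * L / \<epsilon>\<^sup>2)"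
    using pos by (intro ceil) simp
  moreover have "\<forall>\<^sub>F \<epsilon> in at_right 0. real (nat \<lceil>c * ln (real d) * \<sigma>\<^sup>2 / \<epsilon>\<^sup>2\<rceil>)
      \<le> 2 * (c * ln (real d) * \<sigma>\<^sup>2 / \<epsilon>\<^sup>2)"
    using pos c lnd by (intro ceil) simp
  ultimately show "\<forall>\<^sub>F \<epsilon> in at_right 0.
       real (card (sample_indices (num_iterations \<Delta> L \<epsilon>) (batch_size c d \<sigma> \<epsilon>)))
         \<le> 4 * c * (\<Delta> * L * ln (real d) * \<sigma>\<^sup>2 / \<epsilon> ^ 4)"
  proof eventually_elim
    case (elim \<epsilon>)
    have "real (card (sample_indices (num_iterations \<Delta> L \<epsilon>) (batch_size c d \<sigma> \<epsilon>)))
        = real (nat \<lceil>\<Delta> * L / \<epsilon>\<^sup>2\<rceil>) * real (nat \<lceil>c * ln (real d) * \<sigma>\<^sup>2 / \<epsilon>\<^sup>2\<rceil>)"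
      by (simp add: sample_indices_def card_cartesian_product num_iterations_def batch_size_def)
    also have "\<dots> \<le> 2 * (\<Delta> * L / \<epsilon>\<^sup>2) * (2 * (c * ln (real d) * \<sigma>\<^sup>2 / \<epsilon>\<^sup>2))"
      using elim by (intro mult_mono) (use pos in auto)
    also have "\<dots> = 4 * c * (\<Delta> * L * ln (real d) * \<sigma>\<^sup>2 / \<epsilon> ^ 4)"
      by (simp add: power2_eq_square power4_eq_xxxx mult_ac)
    finally show ?case .
  qed
qed (use c in simp)


section \<open>Stationarity of the random output\<close>

theorem corollary1:
  fixes M :: "'w measure"
    and \<zeta> :: "'w \<Rightarrow> 'z::euclidean_space"
    and F :: "real ^ 'n \<Rightarrow> 'z \<Rightarrow> real"
    and gF :: "real ^ 'n \<Rightarrow> 'z \<Rightarrow> real ^ 'n"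
    and f :: "real ^ 'n \<Rightarrow> real"
    and gf :: "real ^ 'n \<Rightarrow> real ^ 'n"
    and X :: "(real ^ 'n) set"
    and L \<sigma> flow \<Delta> c \<rho> \<epsilon> :: real
    and K m :: nat
    and Z :: "nat \<Rightarrow> nat \<Rightarrow> 'w \<Rightarrow> 'z"
    and x :: "nat \<Rightarrow> 'w \<Rightarrow> real ^ 'n"
    and Y :: "'w \<Rightarrow> nat"
  assumes dim: "CARD('n) \<ge> 2"
    and X: "X \<noteq> {}" "closed X" "convex X"
    and M: "prob_space M"
    and \<zeta>: "\<zeta> \<in> borel_measurable M"
    and F_measurable: "(\<lambda>(u, z). F u z) \<in> borel_measurable borel"
    and F_integrable: "\<And>u. integrable M (\<lambda>\<omega>. F u (\<zeta> \<omega>))"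
    and f: "\<And>u. f u = (\<integral>\<omega>. F u (\<zeta> \<omega>) \<partial>M)"
    and gF: "\<And>u z. GDERIV (\<lambda>v. F v z) u :> gF u z"
    and gf: "\<And>u. GDERIV f u :> gf u"
    and A2_mean: "\<And>u. u \<in> X \<Longrightarrow> integrable M (\<lambda>\<omega>. gF u (\<zeta> \<omega>) - gf u)"
                 "\<And>u. u \<in> X \<Longrightarrow> (\<integral>\<omega>. gF u (\<zeta> \<omega>) - gf u \<partial>M) = 0"
    and A2_tail: "\<And>u i. u \<in> X \<Longrightarrow> sub_gaussian M \<sigma> (\<lambda>\<omega>. (gF u (\<zeta> \<omega>) - gf u) $ i)"
    and A3: "L > 0"
            "\<And>u v z. u \<in> X \<Longrightarrow> v \<in> X \<Longrightarrow> norm (gF u z - gF v z) \<le> L * norm (u - v)"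
    and A4: "\<And>u. u \<in> X \<Longrightarrow> f u \<ge> flow"
    and c: "c > 0" "subgaussian_mean_const c"
    and x1_integrable: "integrable M (\<lambda>\<omega>. f (x 1 \<omega>))"
    and \<Delta>: "\<Delta> = (\<integral>\<omega>. f (x 1 \<omega>) \<partial>M) - flow"
    and pos: "\<Delta> > 0" "\<sigma> > 0" "\<rho> > 0" "\<epsilon> > 0"
    and K: "K = num_iterations \<Delta> L \<epsilon>"
    and m: "m = batch_size c CARD('n) \<sigma> \<epsilon>"
    and run: "disfom_run M \<zeta> gF X (\<lambda>z. \<rho> / 2 * (l1norm z)\<^sup>2) (1 / L) (\<epsilon> / L) K m Z x Y"
  shows "(\<integral>\<^sup>+\<omega>. infdist0 (subdiff_constrained X gf (x (Y \<omega> + 1) \<omega>)) \<partial>M)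
           \<le> ennreal ((4 * sqrt (3 + 1 / \<rho> + 2 * \<rho>)
                        + 2 * sqrt (4 * \<rho>\<^sup>2 + 6 * \<rho> + 2) + 2) * \<epsilon>) \<and>
         card (sample_indices K m) = K * m \<and>
         int (K * m) = \<lceil>\<Delta> * L / \<epsilon>\<^sup>2\<rceil> * \<lceil>c * ln (real CARD('n)) * \<sigma>\<^sup>2 / \<epsilon>\<^sup>2\<rceil> \<and>
         (\<exists>C>0. \<forall>\<Delta>' L' \<sigma>' d. \<Delta>' > 0 \<longrightarrow> L' > 0 \<longrightarrow> \<sigma>' > 0 \<longrightarrow> d \<ge> 2 \<longrightarrow>
           (\<forall>\<^sub>F \<epsilon>' in at_right 0.
              real (card (sample_indices (num_iterations \<Delta>' L' \<epsilon>') (batch_size c d \<sigma>' \<epsilon>')))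
                \<le> C * (\<Delta>' * L' * ln (real d) * \<sigma>'\<^sup>2 / \<epsilon>' ^ 4)))"
proof -
  interpret prob_space M by (rule M)
  note run = run[unfolded disfom_run_def]
  define d where "d = CARD('n)"
  have lnd: "ln (real d) > 0"
    using dim by (simp add: d_def)
  have pos_K: "\<Delta> * L / \<epsilon>\<^sup>2 > 0" and pos_m: "c * ln (real d) * \<sigma>\<^sup>2 / \<epsilon>\<^sup>2 > 0"
    using pos A3(1) c(1) lnd by simp_all
  have K_ge: "\<Delta> * L / \<epsilon>\<^sup>2 \<le> real K" and K1: "K \<ge> 1"
    using pos_K unfolding K num_iterations_def by linarith+
  have m_ge: "c * ln (real d) * \<sigma>\<^sup>2 / \<epsilon>\<^sup>2 \<le> real m" and m1: "m \<ge> 1"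
    using pos_m unfolding m batch_size_def d_def[symmetric] by linarith+
  obtain a b \<theta> where ab: "a \<ge> 0" "b \<ge> 0" "\<theta> > 0"
    and const: "a + b + \<theta> \<le> 4 * sqrt (3 + 1 / \<rho> + 2 * \<rho>) + 2 * sqrt (4 * \<rho>\<^sup>2 + 6 * \<rho> + 2) + 2"
    and tradeoff: "\<And>r s w h. r\<^sup>2 / 2 + \<rho> * s\<^sup>2 \<le> h + \<rho> * s + r + w * s + w \<Longrightarrow>
      2 * r + \<rho> * s + w + 1 \<le> a + b * w\<^sup>2 + \<theta> * h"
    using quadratic_tradeoff[OF pos(3)] by blast

  have gF_meas: "(\<lambda>(u, z). gF u z) \<in> borel_measurable (borel \<Otimes>\<^sub>M borel)"
    by (rule borel_measurable_parametric_gradient[OF _ gF]) (use F_measurable in \<open>simp add: borel_prod\<close>)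
  have gF_meas2: "gF u \<in> borel_measurable borel" for u
    using measurable_compose[OF measurable_Pair[OF measurable_const measurable_ident] gF_meas, of u]
    by simp
  have gf_meas: "gf \<in> borel_measurable borel"
    using gf by (rule borel_measurable_gradient)
  have "continuous_on UNIV f"
    using gf unfolding gderiv_def
    by (intro continuous_at_imp_continuous_on ballI has_derivative_continuous)
  then have f_meas: "f \<in> borel_measurable borel"
    by (rule borel_measurable_continuous_onI)
  have lip: "norm (gf u - gf v) \<le> L * norm (u - v)" if uv: "u \<in> X" "v \<in> X" for u v
    by (rule norm_mean_diff_le[OF A2_mean(1)[OF uv(1)] A2_mean(2)[OF uv(1)]
          A2_mean(1)[OF uv(2)] A2_mean(2)[OF uv(2)] A3(2)[OF uv]])

  have Z_indep: "indep_vars (\<lambda>_. borel) (\<lambda>p. Z (fst p) (snd p)) (sample_indices K m)"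
    using run by blast
  have Z_ident: "distr M borel (Z k i) = distr M borel \<zeta>" if "k \<in> {1..K}" "i \<in> {1..m}" for k i
  proof -
    have "\<forall>(k, i)\<in>sample_indices K m. distr M borel (Z k i) = distr M borel \<zeta>"
      using run by blast
    then show ?thesis
      using that by (auto simp: sample_indices_def)
  qed
  have step: "approx_step X (\<lambda>z. \<rho> / 2 * (l1norm z)\<^sup>2) (1 / L) (\<epsilon> / L)
      (x k \<omega>) (minibatch_grad gF m (x k \<omega>) (\<lambda>i. Z k i \<omega>)) (x (k+1) \<omega>)"
    if "k \<in> {1..K}" "\<omega> \<in> space M" for k \<omega>
    using run that by blast
  have x_in: "x k \<omega> \<in> X" if "k \<in> {1..K+1}" "\<omega> \<in> space M" for k \<omega>
  proof (cases "k = 1")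
    case True
    then show ?thesis using run that by blast
  next
    case False
    with that have "k - 1 \<in> {1..K}" "k - 1 + 1 = k" by auto
    then show ?thesis
      using step[of "k - 1" \<omega>] that unfolding approx_step_def by simp
  qed

  define W where "W = (\<lambda>k \<omega>. infnorm (minibatch_grad gF m (x k \<omega>) (\<lambda>i. Z k i \<omega>) - gf (x k \<omega>)))"
  have W_sq: "(\<integral>\<^sup>+\<omega>. ennreal ((W k \<omega>)\<^sup>2) \<partial>M) \<le> ennreal (\<epsilon>\<^sup>2)" if k: "k \<in> {1..K}" for k
  proof -
    let ?T = "\<Pi>\<^sub>M i\<in>{1..m}. (borel :: 'z measure)"
    \<comment> \<open>The squared error as a function of the iterate and the batch, so that the iterate can be frozen.\<close>
    define h where "h = (\<lambda>p. ennreal ((infnorm (minibatch_grad gF m (fst p) (snd p) - gf (fst p)))\<^sup>2))"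
    have h_meas: "h \<in> borel_measurable (borel \<Otimes>\<^sub>M ?T)"
      unfolding h_def
      by (intro measurable_compose[OF _ measurable_ennreal]
          borel_measurable_minibatch_error[OF gF_meas gf_meas, of fst _ _ "\<lambda>i p. snd p i"] measurable_fst
          measurable_compose[OF measurable_snd measurable_component_singleton])
    have "indep_rv M (\<Pi>\<^sub>M j\<in>{1..k}. borel) (\<lambda>\<omega>. \<lambda>j\<in>{1..k}. x j \<omega>) ?T (\<lambda>\<omega>. \<lambda>i\<in>{1..m}. Z k i \<omega>)"
      using run k by blast
    from indep_rv_compose[OF M this measurable_component_singleton[of k] measurable_ident]
    have indep: "indep_rv M borel (x k) ?T (\<lambda>\<omega>. \<lambda>i\<in>{1..m}. Z k i \<omega>)"
      using k by simp
    have restrict: "minibatch_grad gF m u (\<lambda>i\<in>{1..m}. z i) = minibatch_grad gF m u z" for u z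
      by (simp add: minibatch_grad_def)
    have "indep_vars (\<lambda>_. borel) (\<lambda>p. Z (fst p) (snd p)) (Pair k ` {1..m})"
      by (rule indep_vars_subset[OF Z_indep]) (use k in \<open>auto simp: sample_indices_def\<close>)
    from indep_vars_reindex[OF this]
    have Zk_indep: "indep_vars (\<lambda>_. borel) (Z k) {1..m}"
      by (simp add: inj_on_def)
    have "(\<integral>\<^sup>+\<omega>. ennreal ((W k \<omega>)\<^sup>2) \<partial>M) = (\<integral>\<^sup>+\<omega>. \<integral>\<^sup>+\<omega>'. h (x k \<omega>, \<lambda>i\<in>{1..m}. Z k i \<omega>') \<partial>M \<partial>M)"
      unfolding nn_integral_indep_rv[OF M indep h_meas, symmetric] by (simp add: h_def W_def restrict del: One_nat_def)
    also have "\<dots> \<le> (\<integral>\<^sup>+\<omega>. ennreal (\<epsilon>\<^sup>2) \<partial>M)"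
    proof (rule nn_integral_mono)
      fix \<omega>
      assume "\<omega> \<in> space M"
      then have u: "x k \<omega> \<in> X"
        using x_in k by simp
      have "(\<integral>\<^sup>+\<omega>'. h (x k \<omega>, \<lambda>i\<in>{1..m}. Z k i \<omega>') \<partial>M)
          \<le> ennreal (c * ln (real CARD('n)) * \<sigma>\<^sup>2 / real m)"
        unfolding h_def fst_conv snd_conv restrict unfolding minibatch_grad_def
        by (rule minibatch_mean_square_le[OF M c(2) dim m1 pos(2) gF_meas2 \<zeta> Zk_indep Z_ident[OF k]
              A2_mean(1)[OF u] A2_mean(2)[OF u] A2_tail[OF u]])
      also have "\<dots> \<le> ennreal (\<epsilon>\<^sup>2)"
        using m_ge m1 pos by (intro ennreal_leI) (simp add: d_def field_simps)
      finally show "(\<integral>\<^sup>+\<omega>'. h (x k \<omega>, \<lambda>i\<in>{1..m}. Z k i \<omega>') \<partial>M) \<le> ennreal (\<epsilon>\<^sup>2)" .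
    qed
    also have "\<dots> = ennreal (\<epsilon>\<^sup>2)"
      by (simp add: emeasure_space_1)
    finally show ?thesis .
  qed

  let ?T = "(\<Pi>\<^sub>M j\<in>{1..K+1}. (borel :: (real ^ 'n) measure)) \<Otimes>\<^sub>M (\<Pi>\<^sub>M p\<in>sample_indices K m. (borel :: 'z measure))"
  define V where "V = (\<lambda>\<omega>. (\<lambda>j\<in>{1..K+1}. x j \<omega>, \<lambda>p\<in>sample_indices K m. Z (fst p) (snd p) \<omega>))"
  \<comment> \<open>The pathwise bound as a function of all iterates and samples, since these jointly
      are what \<open>Y\<close> is independent of.\<close>
  define B where "B = (\<lambda>(k::nat) v. a * \<epsilon>
      + b / \<epsilon> * (infnorm (minibatch_grad gF m (fst v k) (\<lambda>i. snd v (k, i)) - gf (fst v k)))\<^sup>2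
      + \<theta> * L / \<epsilon> * (f (fst v k) - f (fst v (k + 1))))"
  have B_meas: "B k \<in> borel_measurable ?T" if k: "k \<in> {1..K}" for k
  proof -
    have fst_meas: "(\<lambda>v. fst v j) \<in> borel_measurable ?T" if "j \<in> {1..K+1}" for j
      using that by (rule measurable_compose[OF measurable_fst measurable_component_singleton])
    have snd_meas: "(\<lambda>v. snd v (k, i)) \<in> borel_measurable ?T" if "i \<in> {1..m}" for i
      by (rule measurable_compose[OF measurable_snd measurable_component_singleton])
        (use that k in \<open>simp add: sample_indices_def\<close>)
    show ?thesis
      unfolding B_def using k
      by (intro borel_measurable_add borel_measurable_times borel_measurable_diff borel_measurable_const
          borel_measurable_minibatch_error[OF gF_meas gf_meas] measurable_compose[OF _ f_meas]
          fst_meas snd_meas) auto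
  qed
  have Y_indep: "indep_rv M (count_space {1..K}) Y ?T V"
    using run unfolding V_def by blast
  have Y_law: "distr M (count_space {1..K}) Y = uniform_count_measure {1..K}"
    using run by blast
  have Y_meas: "Y \<in> measurable M (count_space {1..K})" and V_meas: "V \<in> measurable M ?T"
    using Y_indep unfolding indep_rv_def by blast+
  have Y_in: "Y \<omega> \<in> {1..K}" if "\<omega> \<in> space M" for \<omega>
    using measurable_space[OF Y_meas that] by simp
  have B_V: "B k (V \<omega>) = a * \<epsilon> + b / \<epsilon> * (W k \<omega>)\<^sup>2 + \<theta> * L / \<epsilon> * (f (x k \<omega>) - f (x (k+1) \<omega>))"
    if k: "k \<in> {1..K}" for k \<omega>
  proof -
    have "minibatch_grad gF m u (\<lambda>i. snd (V \<omega>) (k, i)) = minibatch_grad gF m u (\<lambda>i. Z k i \<omega>)" for u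
      using k by (simp add: minibatch_grad_def V_def sample_indices_def)
    moreover have "fst (V \<omega>) k = x k \<omega>" "fst (V \<omega>) (k + 1) = x (k + 1) \<omega>"
      using k by (auto simp: V_def)
    ultimately show ?thesis
      by (simp add: B_def W_def)
  qed
  have B_bound: "infdist0 (subdiff_constrained X gf (x (k+1) \<omega>)) \<le> ennreal (B k (V \<omega>))"
      and B_nonneg: "0 \<le> B k (V \<omega>)"
    if k: "k \<in> {1..K}" and \<omega>: "\<omega> \<in> space M" for k \<omega>
  proof -
    have "x k \<omega> \<in> X"
      using k \<omega> by (intro x_in) auto
    note stationarity = approx_step_stationarity[OF X(3) this gf lip A3(1) pos(3,4) step[OF k \<omega>] tradeoff]
    show "infdist0 (subdiff_constrained X gf (x (k+1) \<omega>)) \<le> ennreal (B k (V \<omega>))"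
      unfolding B_V[OF k] W_def by (rule stationarity(1))
    show "0 \<le> B k (V \<omega>)"
      unfolding B_V[OF k] W_def by (rule stationarity(2))
  qed
  have BV_meas: "(\<lambda>\<omega>. B k (V \<omega>)) \<in> borel_measurable M" if "k \<in> {1..K}" for k
    using V_meas B_meas[OF that] by (rule measurable_compose)
  have x_meas: "x k \<in> borel_measurable M" if "k \<in> {1..K+1}" for k
    using run that by blast
  have W_meas: "(\<lambda>\<omega>. (W k \<omega>)\<^sup>2) \<in> borel_measurable M" if k: "k \<in> {1..K}" for k
    unfolding W_def
  proof (rule borel_measurable_minibatch_error[OF gF_meas gf_meas])
    show "Z k i \<in> borel_measurable M" if "i \<in> {1..m}" for i
      using k that Z_indep unfolding indep_vars_def2 sample_indices_def by fastforce
  qed (use k in \<open>simp add: x_meas\<close>)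

  \<comment> \<open>Only the first and the last value of \<open>f\<close> survive: the first is integrable, the last
      is bounded below on \<open>X\<close>.\<close>
  have telescope: "(\<Sum>k=1..K. f (x k \<omega>) - f (x (k+1) \<omega>)) = f (x 1 \<omega>) - f (x (K+1) \<omega>)" for \<omega>
    using K1 by (induction K rule: dec_induct) simp_all
  have sum_B: "(\<Sum>k=1..K. \<integral>\<^sup>+\<omega>. ennreal (B k (V \<omega>)) \<partial>M) \<le> ennreal (real K * ((a + b + \<theta>) * \<epsilon>))"
  proof -
    have "(\<Sum>k=1..K. \<integral>\<^sup>+\<omega>. ennreal (B k (V \<omega>)) \<partial>M) = (\<integral>\<^sup>+\<omega>. (\<Sum>k=1..K. ennreal (B k (V \<omega>))) \<partial>M)"
      by (intro nn_integral_sum[symmetric] measurable_compose[OF BV_meas measurable_ennreal])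
    also have "\<dots> \<le> (\<integral>\<^sup>+\<omega>. ennreal (real K * a * \<epsilon>) + ennreal (b / \<epsilon>) * (\<Sum>k=1..K. ennreal ((W k \<omega>)\<^sup>2))
        + ennreal (\<theta> * L / \<epsilon> * (f (x 1 \<omega>) - flow)) \<partial>M)"
    proof (rule nn_integral_mono)
      fix \<omega>
      assume \<omega>: "\<omega> \<in> space M"
      have "(\<Sum>k=1..K. B k (V \<omega>)) = (\<Sum>k=1..K. a * \<epsilon> + b / \<epsilon> * (W k \<omega>)\<^sup>2 + \<theta> * L / \<epsilon> * (f (x k \<omega>) - f (x (k+1) \<omega>)))"
        by (intro sum.cong B_V) auto
      also have "\<dots> = real K * a * \<epsilon> + b / \<epsilon> * (\<Sum>k=1..K. (W k \<omega>)\<^sup>2) + \<theta> * L / \<epsilon> * (f (x 1 \<omega>) - f (x (K+1) \<omega>))"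
        unfolding telescope[symmetric] by (simp add: sum.distrib sum_distrib_left)
      also have "\<dots> \<le> real K * a * \<epsilon> + b / \<epsilon> * (\<Sum>k=1..K. (W k \<omega>)\<^sup>2) + \<theta> * L / \<epsilon> * (f (x 1 \<omega>) - flow)"
        using A4[OF x_in[of "K+1" \<omega>]] \<omega> ab A3(1) pos by (intro add_left_mono mult_left_mono) auto
      finally have le: "(\<Sum>k=1..K. B k (V \<omega>)) \<le> \<dots>" .
      have "f (x 1 \<omega>) - flow \<ge> 0"
        using A4[OF x_in[of 1 \<omega>]] \<omega> by simp
      then have split: "ennreal (real K * a * \<epsilon> + b / \<epsilon> * (\<Sum>k=1..K. (W k \<omega>)\<^sup>2) + \<theta> * L / \<epsilon> * (f (x 1 \<omega>) - flow))
          = ennreal (real K * a * \<epsilon>) + ennreal (b / \<epsilon> * (\<Sum>k=1..K. (W k \<omega>)\<^sup>2))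
            + ennreal (\<theta> * L / \<epsilon> * (f (x 1 \<omega>) - flow))"
        using ab pos A3(1) by (simp add: sum_nonneg del: One_nat_def flip: ennreal_plus)
      have noise: "ennreal (b / \<epsilon> * (\<Sum>k=1..K. (W k \<omega>)\<^sup>2)) = ennreal (b / \<epsilon>) * (\<Sum>k=1..K. ennreal ((W k \<omega>)\<^sup>2))"
        using ab pos by (subst ennreal_mult) (auto intro: sum_nonneg)
      have "(\<Sum>k=1..K. ennreal (B k (V \<omega>))) = ennreal (\<Sum>k=1..K. B k (V \<omega>))"
        by (rule sum_ennreal) (rule B_nonneg[OF _ \<omega>])
      then show "(\<Sum>k=1..K. ennreal (B k (V \<omega>)))
          \<le> ennreal (real K * a * \<epsilon>) + ennreal (b / \<epsilon>) * (\<Sum>k=1..K. ennreal ((W k \<omega>)\<^sup>2))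
            + ennreal (\<theta> * L / \<epsilon> * (f (x 1 \<omega>) - flow))"
        using ennreal_leI[OF le] unfolding split noise by simp
    qed
    also have "\<dots> = ennreal (real K * a * \<epsilon>) + ennreal (b / \<epsilon>) * (\<Sum>k=1..K. \<integral>\<^sup>+\<omega>. ennreal ((W k \<omega>)\<^sup>2) \<partial>M)
        + (\<integral>\<^sup>+\<omega>. ennreal (\<theta> * L / \<epsilon> * (f (x 1 \<omega>) - flow)) \<partial>M)"
    proof -
      have m1: "(\<lambda>\<omega>. ennreal ((W k \<omega>)\<^sup>2)) \<in> borel_measurable M" if "k \<in> {1..K}" for k
        using W_meas[OF that] by (rule measurable_compose) (rule measurable_ennreal)
      have sum_meas: "(\<lambda>\<omega>. \<Sum>k=1..K. ennreal ((W k \<omega>)\<^sup>2)) \<in> borel_measurable M"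
        by (intro borel_measurable_sum m1)
      have sum_int: "(\<integral>\<^sup>+\<omega>. (\<Sum>k=1..K. ennreal ((W k \<omega>)\<^sup>2)) \<partial>M) = (\<Sum>k=1..K. \<integral>\<^sup>+\<omega>. ennreal ((W k \<omega>)\<^sup>2) \<partial>M)"
        by (intro nn_integral_sum m1)
      have m2: "(\<lambda>\<omega>. ennreal (\<theta> * L / \<epsilon> * (f (x 1 \<omega>) - flow))) \<in> borel_measurable M"
        using measurable_compose[OF x_meas[of 1] f_meas] by simp
      show ?thesis
        using m2 sum_meas sum_int
        by (simp add: nn_integral_add nn_integral_cmult emeasure_space_1 del: sum_ennreal One_nat_def)
    qed
    also have "(\<integral>\<^sup>+\<omega>. ennreal (\<theta> * L / \<epsilon> * (f (x 1 \<omega>) - flow)) \<partial>M) = ennreal (\<theta> * L / \<epsilon> * \<Delta>)"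
    proof (subst nn_integral_eq_integral)
      show "integrable M (\<lambda>\<omega>. \<theta> * L / \<epsilon> * (f (x 1 \<omega>) - flow))"
        using x1_integrable by simp
      show "AE \<omega> in M. 0 \<le> \<theta> * L / \<epsilon> * (f (x 1 \<omega>) - flow)"
        using A4[OF x_in[of 1]] ab A3(1) pos by (intro AE_I2) simp
      show "ennreal (\<integral>\<omega>. \<theta> * L / \<epsilon> * (f (x 1 \<omega>) - flow) \<partial>M) = ennreal (\<theta> * L / \<epsilon> * \<Delta>)"
        using x1_integrable by (simp add: \<Delta> prob_space)
    qed
    also have "ennreal (b / \<epsilon>) * (\<Sum>k=1..K. \<integral>\<^sup>+\<omega>. ennreal ((W k \<omega>)\<^sup>2) \<partial>M)
        \<le> ennreal (b / \<epsilon>) * (\<Sum>k=1..K. ennreal (\<epsilon>\<^sup>2))"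
      by (intro mult_left_mono sum_mono W_sq) auto
    also have "(\<Sum>k=1..K. ennreal (\<epsilon>\<^sup>2)) = ennreal (real K * \<epsilon>\<^sup>2)"
      by (simp add: ennreal_mult ennreal_of_nat_eq_real_of_nat)
    also have "ennreal (real K * a * \<epsilon>) + ennreal (b / \<epsilon>) * ennreal (real K * \<epsilon>\<^sup>2) + ennreal (\<theta> * L / \<epsilon> * \<Delta>)
        = ennreal (real K * a * \<epsilon> + b / \<epsilon> * (real K * \<epsilon>\<^sup>2) + \<theta> * L / \<epsilon> * \<Delta>)"
      using ab pos A3(1) by (simp add: ennreal_plus flip: ennreal_mult)
    also have "\<dots> \<le> ennreal (real K * ((a + b + \<theta>) * \<epsilon>))"
    proof (rule ennreal_leI)
      have "\<theta> * \<epsilon> * (\<Delta> * L / \<epsilon>\<^sup>2) \<le> \<theta> * \<epsilon> * real K"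
        using K_ge ab pos by (intro mult_left_mono) auto
      then show "real K * a * \<epsilon> + b / \<epsilon> * (real K * \<epsilon>\<^sup>2) + \<theta> * L / \<epsilon> * \<Delta> \<le> real K * ((a + b + \<theta>) * \<epsilon>)"
        using pos by (simp add: field_simps power2_eq_square)
    qed
    finally show ?thesis
      by (simp add: add_mono)
  qed
  \<comment> \<open>The distance at the output may fail to be measurable; all that enters is that its integral is monotone.\<close>
  have "(\<integral>\<^sup>+\<omega>. infdist0 (subdiff_constrained X gf (x (Y \<omega> + 1) \<omega>)) \<partial>M)
      \<le> (\<integral>\<^sup>+\<omega>. ennreal (B (Y \<omega>) (V \<omega>)) \<partial>M)"
    using B_bound Y_in by (intro nn_integral_mono) blast
  also have "\<dots> = (\<Sum>k=1..K. \<integral>\<^sup>+\<omega>. ennreal (B k (V \<omega>)) \<partial>M) / of_nat K"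
    using nn_integral_uniform_index[OF M _ _ Y_law Y_indep, of "\<lambda>k v. ennreal (B k v)"] K1
      measurable_compose[OF B_meas measurable_ennreal] by simp
  also have "\<dots> \<le> ennreal (real K * ((a + b + \<theta>) * \<epsilon>)) / of_nat K"
    using sum_B by (rule divide_right_mono_ennreal)
  also have "\<dots> = ennreal ((a + b + \<theta>) * \<epsilon>)"
    using K1 ab pos by (simp add: ennreal_of_nat_eq_real_of_nat divide_ennreal)
  also have "\<dots> \<le> ennreal ((4 * sqrt (3 + 1 / \<rho> + 2 * \<rho>) + 2 * sqrt (4 * \<rho>\<^sup>2 + 6 * \<rho> + 2) + 2) * \<epsilon>)"
    using const pos by (intro ennreal_leI mult_right_mono) auto
  finally have main: "(\<integral>\<^sup>+\<omega>. infdist0 (subdiff_constrained X gf (x (Y \<omega> + 1) \<omega>)) \<partial>M)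
      \<le> ennreal ((4 * sqrt (3 + 1 / \<rho> + 2 * \<rho>) + 2 * sqrt (4 * \<rho>\<^sup>2 + 6 * \<rho> + 2) + 2) * \<epsilon>)" .
  have "card (sample_indices K m) = K * m"
    by (simp add: sample_indices_def card_cartesian_product)
  moreover have "int (K * m) = \<lceil>\<Delta> * L / \<epsilon>\<^sup>2\<rceil> * \<lceil>c * ln (real CARD('n)) * \<sigma>\<^sup>2 / \<epsilon>\<^sup>2\<rceil>"
    using pos_K pos_m unfolding K m num_iterations_def batch_size_def d_def by simp
  ultimately show ?thesis
    using main num_samples_bigo[OF c(1)] by blast
qed

end
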